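(* Given any set $X$, the category $\mathsf{Cat}_X$ of (small) categories with set of objects $X$ and identity-on-objects functors is $\mathrm{Equ}$-saturating.
   Context: $\mathsf{Cat}_X$ is the fiber above $X$ of the fibration $(\;)_0:\mathsf{Cat}\to\mathsf{Set}$ sending a category to its set of objects. An internal equivalence relation on $\mathbb{C}$ in $\mathsf{Cat}_X$ is an equivalence relation on parallel pairs of morphisms of $\mathbb{C}$ compatible with composition. In a finitely complete category, a monomorphism $u:U\rightarrowtail X$ is saturated with respect to an internal equivalence relation $T$ on $X$ when the square formed by $u^{-1}T\to T$, $u$ and the projections $d_0$ (from $u^{-1}T$ to $U$ and from $T$ to $X$) is a pullback, where $u^{-1}T$ is the inverse image of $T$ along $u$. A finitely complete category $\mathbb{E}$ is $\mathrm{Equ}$-saturating when, for any monomorphism $u:U\rightarrowtail X$ and any internal equivalence relation $S$ on $U$, among the internal equivalence relations $T$ on $X$ such that $u$ is saturated with respect to $T$ and $u^{-1}T\subset S$, there is a largest one. *)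

theory Defs
  imports Main "HOL-Library.FuncSet" "HOL-Library.Infinite_Typeclass"
begin

section \<open>Categories, functors and finite limits\<close>

text \<open>
  The values of the structure maps of a category outside of its objects, its arrows and its
  composable pairs carry no information.  \<open>Comp C g f\<close> is the composite "\<open>g\<close> after \<open>f\<close>".
\<close>

record ('o, 'a) cat =
  Obj :: "'o set"
  Arr :: "'a set"
  Dom :: "'a \<Rightarrow> 'o"
  Cod :: "'a \<Rightarrow> 'o"
  Ident :: "'o \<Rightarrow> 'a"
  Comp :: "'a \<Rightarrow> 'a \<Rightarrow> 'a"

definition hom_set :: "('o, 'a) cat \<Rightarrow> 'o \<Rightarrow> 'o \<Rightarrow> 'a set" where
  "hom_set C x y = {f \<in> Arr C. Dom C f = x \<and> Cod C f = y}"

definition category :: "('o, 'a) cat \<Rightarrow> bool" where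
  "category C \<longleftrightarrow>
     (\<forall>f\<in>Arr C. Dom C f \<in> Obj C \<and> Cod C f \<in> Obj C) \<and>
     (\<forall>x\<in>Obj C. Ident C x \<in> hom_set C x x) \<and>
     (\<forall>f\<in>Arr C. \<forall>g\<in>Arr C. Cod C f = Dom C g \<longrightarrow> Comp C g f \<in> hom_set C (Dom C f) (Cod C g)) \<and>
     (\<forall>f\<in>Arr C. Comp C f (Ident C (Dom C f)) = f \<and> Comp C (Ident C (Cod C f)) f = f) \<and>
     (\<forall>f\<in>Arr C. \<forall>g\<in>Arr C. \<forall>h\<in>Arr C. Cod C f = Dom C g \<and> Cod C g = Dom C h \<longrightarrow>
        Comp C h (Comp C g f) = Comp C (Comp C h g) f)"

definition is_functor ::
  "('o, 'a) cat \<Rightarrow> ('p, 'b) cat \<Rightarrow> ('o \<Rightarrow> 'p) \<Rightarrow> ('a \<Rightarrow> 'b) \<Rightarrow> bool" where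
  "is_functor A B F\<^sub>0 F\<^sub>1 \<longleftrightarrow>
     category A \<and> category B \<and>
     (\<forall>x\<in>Obj A. F\<^sub>0 x \<in> Obj B \<and> F\<^sub>1 (Ident A x) = Ident B (F\<^sub>0 x)) \<and>
     (\<forall>f\<in>Arr A. F\<^sub>1 f \<in> hom_set B (F\<^sub>0 (Dom A f)) (F\<^sub>0 (Cod A f))) \<and>
     (\<forall>f\<in>Arr A. \<forall>g\<in>Arr A. Cod A f = Dom A g \<longrightarrow> F\<^sub>1 (Comp A g f) = Comp B (F\<^sub>1 g) (F\<^sub>1 f))"

definition is_cone ::
  "('j, 'k) cat \<Rightarrow> ('o, 'a) cat \<Rightarrow> ('j \<Rightarrow> 'o) \<Rightarrow> ('k \<Rightarrow> 'a) \<Rightarrow> 'o \<Rightarrow> ('j \<Rightarrow> 'a) \<Rightarrow> bool" where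
  "is_cone J C F\<^sub>0 F\<^sub>1 L p \<longleftrightarrow>
     L \<in> Obj C \<and>
     (\<forall>j\<in>Obj J. p j \<in> hom_set C L (F\<^sub>0 j)) \<and>
     (\<forall>k\<in>Arr J. Comp C (F\<^sub>1 k) (p (Dom J k)) = p (Cod J k))"

definition is_limit ::
  "('j, 'k) cat \<Rightarrow> ('o, 'a) cat \<Rightarrow> ('j \<Rightarrow> 'o) \<Rightarrow> ('k \<Rightarrow> 'a) \<Rightarrow> 'o \<Rightarrow> ('j \<Rightarrow> 'a) \<Rightarrow> bool" where
  "is_limit J C F\<^sub>0 F\<^sub>1 L p \<longleftrightarrow>
     is_cone J C F\<^sub>0 F\<^sub>1 L p \<and>
     (\<forall>Z q. is_cone J C F\<^sub>0 F\<^sub>1 Z q \<longrightarrow>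
        (\<exists>!h. h \<in> hom_set C Z L \<and> (\<forall>j\<in>Obj J. Comp C (p j) h = q j)))"

text \<open>
  Every finite category is isomorphic to one whose objects and arrows are natural numbers, so
  these suffice as shapes of finite diagrams.
\<close>

definition finitely_complete :: "('o, 'a) cat \<Rightarrow> bool" where
  "finitely_complete C \<longleftrightarrow>
     category C \<and>
     (\<forall>(J :: (nat, nat) cat) F\<^sub>0 F\<^sub>1.
        finite (Obj J) \<and> finite (Arr J) \<and> is_functor J C F\<^sub>0 F\<^sub>1 \<longrightarrow>
        (\<exists>L p. is_limit J C F\<^sub>0 F\<^sub>1 L p))"

definition is_product :: "('o, 'a) cat \<Rightarrow> 'o \<Rightarrow> 'o \<Rightarrow> 'o \<Rightarrow> 'a \<Rightarrow> 'a \<Rightarrow> bool" where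
  "is_product C A B P p q \<longleftrightarrow>
     p \<in> hom_set C P A \<and> q \<in> hom_set C P B \<and>
     (\<forall>Z. \<forall>a\<in>hom_set C Z A. \<forall>b\<in>hom_set C Z B.
        \<exists>!h. h \<in> hom_set C Z P \<and> Comp C p h = a \<and> Comp C q h = b)"

text \<open>
  \<open>is_pullback C f g P p q\<close>: the square \<open>f \<circ> p = g \<circ> q\<close> with apex \<open>P\<close> is a pullback of the
  cospan \<open>(f, g)\<close>.
\<close>

definition is_pullback :: "('o, 'a) cat \<Rightarrow> 'a \<Rightarrow> 'a \<Rightarrow> 'o \<Rightarrow> 'a \<Rightarrow> 'a \<Rightarrow> bool" where
  "is_pullback C f g P p q \<longleftrightarrow>
     f \<in> Arr C \<and> g \<in> Arr C \<and> Cod C f = Cod C g \<and>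
     p \<in> hom_set C P (Dom C f) \<and> q \<in> hom_set C P (Dom C g) \<and>
     Comp C f p = Comp C g q \<and>
     (\<forall>Z. \<forall>a\<in>hom_set C Z (Dom C f). \<forall>b\<in>hom_set C Z (Dom C g).
        Comp C f a = Comp C g b \<longrightarrow>
        (\<exists>!h. h \<in> hom_set C Z P \<and> Comp C p h = a \<and> Comp C q h = b))"

definition mono_arrow :: "('o, 'a) cat \<Rightarrow> 'a \<Rightarrow> bool" where
  "mono_arrow C u \<longleftrightarrow>
     u \<in> Arr C \<and>
     (\<forall>Z. \<forall>f\<in>hom_set C Z (Dom C u). \<forall>g\<in>hom_set C Z (Dom C u).
        Comp C u f = Comp C u g \<longrightarrow> f = g)"


section \<open>Internal relations\<close>

text \<open>
  An internal relation \<open>R \<rightarrowtail> X \<times> X\<close> is given by its jointly monic pair of projections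
  \<open>d\<^sub>0, d\<^sub>1 : R \<rightarrow> X\<close>; its apex is \<open>R = Dom C d\<^sub>0\<close>.
\<close>

definition internal_relation :: "('o, 'a) cat \<Rightarrow> 'o \<Rightarrow> 'a \<Rightarrow> 'a \<Rightarrow> bool" where
  "internal_relation C X d\<^sub>0 d\<^sub>1 \<longleftrightarrow>
     d\<^sub>0 \<in> hom_set C (Dom C d\<^sub>0) X \<and> d\<^sub>1 \<in> hom_set C (Dom C d\<^sub>0) X \<and>
     (\<forall>Z. \<forall>f\<in>hom_set C Z (Dom C d\<^sub>0). \<forall>g\<in>hom_set C Z (Dom C d\<^sub>0).
        Comp C d\<^sub>0 f = Comp C d\<^sub>0 g \<and> Comp C d\<^sub>1 f = Comp C d\<^sub>1 g \<longrightarrow> f = g)"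

text \<open>
  The conjuncts after the first are reflexivity, symmetry and transitivity; the last one says that
  the pair of outer projections of \<open>R \<times>\<^sub>X R\<close> factors through \<open>R\<close>.
\<close>

definition internal_equivalence :: "('o, 'a) cat \<Rightarrow> 'o \<Rightarrow> 'a \<Rightarrow> 'a \<Rightarrow> bool" where
  "internal_equivalence C X d\<^sub>0 d\<^sub>1 \<longleftrightarrow>
     internal_relation C X d\<^sub>0 d\<^sub>1 \<and>
     (\<exists>s\<in>hom_set C X (Dom C d\<^sub>0). Comp C d\<^sub>0 s = Ident C X \<and> Comp C d\<^sub>1 s = Ident C X) \<and>
     (\<exists>t\<in>hom_set C (Dom C d\<^sub>0) (Dom C d\<^sub>0). Comp C d\<^sub>0 t = d\<^sub>1 \<and> Comp C d\<^sub>1 t = d\<^sub>0) \<and>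
     (\<forall>P p q. is_pullback C d\<^sub>1 d\<^sub>0 P p q \<longrightarrow>
        (\<exists>m\<in>hom_set C P (Dom C d\<^sub>0).
           Comp C d\<^sub>0 m = Comp C d\<^sub>0 p \<and> Comp C d\<^sub>1 m = Comp C d\<^sub>1 q))"

text \<open>Inclusion of relations on the same object, i.e. of subobjects of \<open>X \<times> X\<close>.\<close>

definition relation_le :: "('o, 'a) cat \<Rightarrow> 'a \<Rightarrow> 'a \<Rightarrow> 'a \<Rightarrow> 'a \<Rightarrow> bool" where
  "relation_le C d\<^sub>0 d\<^sub>1 e\<^sub>0 e\<^sub>1 \<longleftrightarrow>
     (\<exists>i\<in>hom_set C (Dom C d\<^sub>0) (Dom C e\<^sub>0). Comp C e\<^sub>0 i = d\<^sub>0 \<and> Comp C e\<^sub>1 i = d\<^sub>1)"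

text \<open>
  For \<open>u : U \<rightarrow> X\<close> and a relation \<open>(d\<^sub>0, d\<^sub>1)\<close> on \<open>X\<close> with apex \<open>T\<close>, the relation \<open>(v\<^sub>0, v\<^sub>1)\<close> on
  \<open>U\<close> with comparison arrow \<open>t : V \<rightarrow> T\<close> is the inverse image \<open>u\<^sup>-\<^sup>1T\<close>: the pullback of
  \<open>m = \<langle>d\<^sub>0, d\<^sub>1\<rangle> : T \<rightarrow> X \<times> X\<close> along \<open>w = u \<times> u : U \<times> U \<rightarrow> X \<times> X\<close>, where \<open>n = \<langle>v\<^sub>0, v\<^sub>1\<rangle>\<close>.
\<close>

definition is_inverse_image ::
  "('o, 'a) cat \<Rightarrow> 'a \<Rightarrow> 'a \<Rightarrow> 'a \<Rightarrow> 'a \<Rightarrow> 'a \<Rightarrow> 'a \<Rightarrow> bool" where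
  "is_inverse_image C u d\<^sub>0 d\<^sub>1 v\<^sub>0 v\<^sub>1 t \<longleftrightarrow>
     (\<exists>P p\<^sub>0 p\<^sub>1 Q q\<^sub>0 q\<^sub>1.
        is_product C (Cod C u) (Cod C u) P p\<^sub>0 p\<^sub>1 \<and>
        is_product C (Dom C u) (Dom C u) Q q\<^sub>0 q\<^sub>1 \<and>
        (\<exists>m\<in>hom_set C (Dom C d\<^sub>0) P. \<exists>w\<in>hom_set C Q P. \<exists>n\<in>hom_set C (Dom C v\<^sub>0) Q.
           Comp C p\<^sub>0 m = d\<^sub>0 \<and> Comp C p\<^sub>1 m = d\<^sub>1 \<and>
           Comp C p\<^sub>0 w = Comp C u q\<^sub>0 \<and> Comp C p\<^sub>1 w = Comp C u q\<^sub>1 \<and>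
           Comp C q\<^sub>0 n = v\<^sub>0 \<and> Comp C q\<^sub>1 n = v\<^sub>1 \<and>
           is_pullback C m w (Dom C v\<^sub>0) t n))"

text \<open>
  Inverse images exist in a finitely complete category and are unique up to isomorphism, so in the
  next three definitions the choice of one is immaterial.
\<close>

definition saturated :: "('o, 'a) cat \<Rightarrow> 'a \<Rightarrow> 'a \<Rightarrow> 'a \<Rightarrow> bool" where
  "saturated C u d\<^sub>0 d\<^sub>1 \<longleftrightarrow>
     (\<exists>v\<^sub>0 v\<^sub>1 t. is_inverse_image C u d\<^sub>0 d\<^sub>1 v\<^sub>0 v\<^sub>1 t \<and> is_pullback C d\<^sub>0 u (Dom C v\<^sub>0) t v\<^sub>0)"

definition inverse_image_le :: "('o, 'a) cat \<Rightarrow> 'a \<Rightarrow> 'a \<Rightarrow> 'a \<Rightarrow> 'a \<Rightarrow> 'a \<Rightarrow> bool" where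
  "inverse_image_le C u d\<^sub>0 d\<^sub>1 s\<^sub>0 s\<^sub>1 \<longleftrightarrow>
     (\<exists>v\<^sub>0 v\<^sub>1 t. is_inverse_image C u d\<^sub>0 d\<^sub>1 v\<^sub>0 v\<^sub>1 t \<and> relation_le C v\<^sub>0 v\<^sub>1 s\<^sub>0 s\<^sub>1)"

definition saturating_candidate ::
  "('o, 'a) cat \<Rightarrow> 'a \<Rightarrow> 'a \<Rightarrow> 'a \<Rightarrow> 'a \<Rightarrow> 'a \<Rightarrow> bool" where
  "saturating_candidate C u s\<^sub>0 s\<^sub>1 d\<^sub>0 d\<^sub>1 \<longleftrightarrow>
     internal_equivalence C (Cod C u) d\<^sub>0 d\<^sub>1 \<and>
     saturated C u d\<^sub>0 d\<^sub>1 \<and>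
     inverse_image_le C u d\<^sub>0 d\<^sub>1 s\<^sub>0 s\<^sub>1"

definition Equ_saturating :: "('o, 'a) cat \<Rightarrow> bool" where
  "Equ_saturating C \<longleftrightarrow>
     finitely_complete C \<and>
     (\<forall>u s\<^sub>0 s\<^sub>1. mono_arrow C u \<and> internal_equivalence C (Dom C u) s\<^sub>0 s\<^sub>1 \<longrightarrow>
        (\<exists>d\<^sub>0 d\<^sub>1. saturating_candidate C u s\<^sub>0 s\<^sub>1 d\<^sub>0 d\<^sub>1 \<and>
           (\<forall>e\<^sub>0 e\<^sub>1. saturating_candidate C u s\<^sub>0 s\<^sub>1 e\<^sub>0 e\<^sub>1 \<longrightarrow> relation_le C e\<^sub>0 e\<^sub>1 d\<^sub>0 d\<^sub>1)))"


section \<open>The category of small categories with a fixed set of objects\<close>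

text \<open>
  A type \<open>'u\<close> plays the role of the universe: sets are subsets of \<open>'u\<close>, and a small category is one
  whose objects and arrows are elements of \<open>'u\<close>.  For an infinite \<open>'u\<close> this universe is closed under
  finite limits, since \<open>'u \<times> 'u\<close> embeds into \<open>'u\<close>; for a finite \<open>'u\<close> it is in general not.

  An arrow \<open>A \<rightarrow> B\<close> is a triple \<open>(A, B, f)\<close> such that the identity map on objects and the map \<open>f\<close>
  on arrows form a functor.  The map \<open>f\<close> is \<open>undefined\<close> outside of \<open>Arr A\<close>, so equality of arrows is
  equality of functors.  Two records that differ only in the irrelevant values of their structure
  maps are distinct isomorphic objects.
\<close>

type_synonym 'u small_cat = "('u, 'u) cat"
type_synonym 'u io_functor = "'u small_cat \<times> 'u small_cat \<times> ('u \<Rightarrow> 'u)"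

definition Cat_over :: "'u set \<Rightarrow> ('u small_cat, 'u io_functor) cat" where
  "Cat_over X =
     \<lparr> Obj = {A. category A \<and> Obj A = X},
       Arr = {(A, B, f). Obj A = X \<and> Obj B = X \<and> is_functor A B (\<lambda>x. x) f \<and>
                f \<in> extensional (Arr A)},
       Dom = (\<lambda>(A, B, f). A),
       Cod = (\<lambda>(A, B, f). B),
       Ident = (\<lambda>A. (A, A, restrict (\<lambda>a. a) (Arr A))),
       Comp = (\<lambda>(B', D, g) (A, B, f). (A, D, compose (Arr A) g f)) \<rparr>"

end

theory Submission
  imports Defs
begin

text \<open>
  In \<open>Cat_over X\<close> monomorphisms are the functors that are injective on arrows, and products,
  pullbacks and internal relations are computed on arrows; so an internal equivalence relation on
  \<open>C\<close> is a congruence \<open>R\<close>, and it is a candidate for \<open>u : U \<rightarrow> C\<close> and \<open>S\<close> iff any two \<open>R\<close>-related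
  arrows of which one lies in the image of \<open>u\<close> are the images of two \<open>S\<close>-related arrows.  This says
  that \<open>R\<close> is contained in a certain equivalence relation \<open>E\<close> on the arrows of \<open>C\<close>, and the largest
  congruence contained in \<open>E\<close> is the syntactic one: it relates parallel \<open>f\<close> and \<open>g\<close> when
  \<open>h f k\<close> and \<open>h g k\<close> are \<open>E\<close>-related for all composable \<open>h\<close> and \<open>k\<close>.
\<close>

section \<open>Functors that fix the objects\<close>

text \<open>The notions involved are universal properties, tested against all objects of
  \<open>Cat_over X\<close>, whereas the argument concerns individual arrows. The bridge is the
  tabulation: a span that is jointly injective on arrows and has a prescribed set of pairs as image.
  A set of parallel pairs closed under identities and composition is itself a category over
  \<open>X\<close>; used as a test object, it turns a universal property into injectivity and
  surjectivity on arrows. Its arrows are pairs, which have to be coded inside the universe; this,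
  like the coding of limits, is where infinity of \<open>'u\<close> enters.

  The relation \<open>E\<close> is forced. On pairs that avoid the image of \<open>u\<close> the
  candidate condition demands nothing, so the complement of the image is a single class, beside the
  images of the classes of \<open>S\<close>. In general \<open>E\<close> respects neither
  composition nor sources and targets. Passing to the syntactic congruence repairs both, and every
  congruence inside \<open>E\<close> survives because congruences are stable under contexts.\<close>

lemma category_simps:
  assumes "category C"
  shows category_Dom: "f \<in> Arr C \<Longrightarrow> Dom C f \<in> Obj C"
    and category_Cod: "f \<in> Arr C \<Longrightarrow> Cod C f \<in> Obj C"
    and category_Ident: "x \<in> Obj C \<Longrightarrow> Ident C x \<in> Arr C"
    and category_Dom_Ident: "x \<in> Obj C \<Longrightarrow> Dom C (Ident C x) = x"
    and category_Cod_Ident: "x \<in> Obj C \<Longrightarrow> Cod C (Ident C x) = x"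
    and category_Comp: "f \<in> Arr C \<Longrightarrow> g \<in> Arr C \<Longrightarrow> Cod C f = Dom C g \<Longrightarrow> Comp C g f \<in> Arr C"
    and category_Dom_Comp:
      "f \<in> Arr C \<Longrightarrow> g \<in> Arr C \<Longrightarrow> Cod C f = Dom C g \<Longrightarrow> Dom C (Comp C g f) = Dom C f"
    and category_Cod_Comp:
      "f \<in> Arr C \<Longrightarrow> g \<in> Arr C \<Longrightarrow> Cod C f = Dom C g \<Longrightarrow> Cod C (Comp C g f) = Cod C g"
    and category_Comp_Ident_right: "f \<in> Arr C \<Longrightarrow> Dom C f = x \<Longrightarrow> Comp C f (Ident C x) = f"
    and category_Comp_Ident_left: "f \<in> Arr C \<Longrightarrow> Cod C f = x \<Longrightarrow> Comp C (Ident C x) f = f"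
    and category_Comp_assoc:
      "f \<in> Arr C \<Longrightarrow> g \<in> Arr C \<Longrightarrow> h \<in> Arr C \<Longrightarrow> Cod C f = Dom C g \<Longrightarrow> Cod C g = Dom C h \<Longrightarrow>
        Comp C (Comp C h g) f = Comp C h (Comp C g f)"
  using assms unfolding category_def hom_set_def by auto

lemma hom_set_iff: "f \<in> hom_set C x y \<longleftrightarrow> f \<in> Arr C \<and> Dom C f = x \<and> Cod C f = y"
  unfolding hom_set_def by simp

lemma categoryI:
  assumes "\<And>f. f \<in> Arr C \<Longrightarrow> Dom C f \<in> Obj C" "\<And>f. f \<in> Arr C \<Longrightarrow> Cod C f \<in> Obj C"
    and "\<And>x. x \<in> Obj C \<Longrightarrow> Ident C x \<in> hom_set C x x"
    and "\<And>f g. f \<in> Arr C \<Longrightarrow> g \<in> Arr C \<Longrightarrow> Cod C f = Dom C g \<Longrightarrow>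
      Comp C g f \<in> hom_set C (Dom C f) (Cod C g)"
    and "\<And>f. f \<in> Arr C \<Longrightarrow> Comp C f (Ident C (Dom C f)) = f"
    and "\<And>f. f \<in> Arr C \<Longrightarrow> Comp C (Ident C (Cod C f)) f = f"
    and "\<And>f g h. f \<in> Arr C \<Longrightarrow> g \<in> Arr C \<Longrightarrow> h \<in> Arr C \<Longrightarrow> Cod C f = Dom C g \<Longrightarrow>
      Cod C g = Dom C h \<Longrightarrow> Comp C h (Comp C g f) = Comp C (Comp C h g) f"
  shows "category C"
  using assms unfolding category_def by auto

lemma is_functorI:
  assumes "category A" "category B"
    and "\<And>x. x \<in> Obj A \<Longrightarrow> F\<^sub>0 x \<in> Obj B" "\<And>x. x \<in> Obj A \<Longrightarrow> F\<^sub>1 (Ident A x) = Ident B (F\<^sub>0 x)"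
    and "\<And>f. f \<in> Arr A \<Longrightarrow> F\<^sub>1 f \<in> hom_set B (F\<^sub>0 (Dom A f)) (F\<^sub>0 (Cod A f))"
    and "\<And>f g. f \<in> Arr A \<Longrightarrow> g \<in> Arr A \<Longrightarrow> Cod A f = Dom A g \<Longrightarrow>
      F\<^sub>1 (Comp A g f) = Comp B (F\<^sub>1 g) (F\<^sub>1 f)"
  shows "is_functor A B F\<^sub>0 F\<^sub>1"
  using assms unfolding is_functor_def by auto

lemma is_functor_comp:
  assumes "is_functor A B F\<^sub>0 F\<^sub>1" "is_functor B C G\<^sub>0 G\<^sub>1"
  shows "is_functor A C (\<lambda>x. G\<^sub>0 (F\<^sub>0 x)) (\<lambda>f. G\<^sub>1 (F\<^sub>1 f))"
  using assms unfolding is_functor_def hom_set_def by auto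

lemma is_functor_cong:
  assumes "is_functor A B F\<^sub>0 F\<^sub>1" "\<And>f. f \<in> Arr A \<Longrightarrow> G\<^sub>1 f = F\<^sub>1 f"
  shows "is_functor A B F\<^sub>0 G\<^sub>1"
proof -
  have "category A" using assms(1) unfolding is_functor_def by simp
  then show ?thesis
    using assms unfolding is_functor_def by (auto simp: category_simps)
qed

section \<open>Arrows of \<open>Cat_over X\<close> as maps between sets of arrows\<close>

definition arr_map :: "'u io_functor \<Rightarrow> 'u \<Rightarrow> 'u" where
  "arr_map u = snd (snd u)"

lemma Obj_Cat_over: "A \<in> Obj (Cat_over X) \<longleftrightarrow> category A \<and> Obj A = X"
  unfolding Cat_over_def by simp

lemma hom_Cat_over_iff:
  "u \<in> hom_set (Cat_over X) A B \<longleftrightarrow>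
     u = (A, B, arr_map u) \<and> Obj A = X \<and> Obj B = X \<and> is_functor A B (\<lambda>x. x) (arr_map u) \<and>
     arr_map u \<in> extensional (Arr A)"
  unfolding hom_set_def Cat_over_def arr_map_def by (cases u) auto

lemma hom_Cat_overI:
  assumes "is_functor A B (\<lambda>x. x) f" "Obj A = X" "Obj B = X"
  shows "(A, B, restrict f (Arr A)) \<in> hom_set (Cat_over X) A B"
  using assms is_functor_cong[OF assms(1), of "restrict f (Arr A)"]
  unfolding hom_Cat_over_iff arr_map_def by auto

lemma hom_Cat_overD:
  assumes "u \<in> hom_set (Cat_over X) A B"
  shows hom_category_dom: "category A" and hom_category_cod: "category B"
    and hom_Obj_dom: "Obj A = X" and hom_Obj_cod: "Obj B = X"
    and hom_Dom: "Dom (Cat_over X) u = A" and hom_Cod: "Cod (Cat_over X) u = B"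
    and hom_Arr: "u \<in> Arr (Cat_over X)"
    and arr_map_Arr: "f \<in> Arr A \<Longrightarrow> arr_map u f \<in> Arr B"
    and Dom_arr_map: "f \<in> Arr A \<Longrightarrow> Dom B (arr_map u f) = Dom A f"
    and Cod_arr_map: "f \<in> Arr A \<Longrightarrow> Cod B (arr_map u f) = Cod A f"
    and arr_map_Ident: "x \<in> X \<Longrightarrow> arr_map u (Ident A x) = Ident B x"
    and arr_map_Comp: "f \<in> Arr A \<Longrightarrow> g \<in> Arr A \<Longrightarrow> Cod A f = Dom A g \<Longrightarrow>
      arr_map u (Comp A g f) = Comp B (arr_map u g) (arr_map u f)"
proof -
  note h = assms[unfolded hom_set_iff]
    assms[unfolded hom_Cat_over_iff is_functor_def, unfolded hom_set_iff]
  show "category A" "category B" "Obj A = X" "Obj B = X" "Dom (Cat_over X) u = A"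
    "Cod (Cat_over X) u = B" "u \<in> Arr (Cat_over X)"
    using h by simp_all
  show "f \<in> Arr A \<Longrightarrow> arr_map u f \<in> Arr B"
    "f \<in> Arr A \<Longrightarrow> Dom B (arr_map u f) = Dom A f"
    "f \<in> Arr A \<Longrightarrow> Cod B (arr_map u f) = Cod A f"
    "x \<in> X \<Longrightarrow> arr_map u (Ident A x) = Ident B x"
    "f \<in> Arr A \<Longrightarrow> g \<in> Arr A \<Longrightarrow> Cod A f = Dom A g \<Longrightarrow>
      arr_map u (Comp A g f) = Comp B (arr_map u g) (arr_map u f)"
    using h(2) by auto
qed

lemma Arr_Cat_over_hom:
  "u \<in> Arr (Cat_over X) \<Longrightarrow> u \<in> hom_set (Cat_over X) (Dom (Cat_over X) u) (Cod (Cat_over X) u)"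
  by (simp add: hom_set_iff)

text \<open>The maps on arrows are extensional, so agreement on \<open>Arr A\<close> suffices.
  Equations between arrows of \<open>Cat_over X\<close> are checked pointwise through this
  lemma.\<close>

lemma hom_Cat_over_eqI:
  assumes "u \<in> hom_set (Cat_over X) A B" "v \<in> hom_set (Cat_over X) A B"
    and "\<And>f. f \<in> Arr A \<Longrightarrow> arr_map u f = arr_map v f"
  shows "u = v"
proof -
  have "arr_map u = arr_map v"
    using assms unfolding hom_Cat_over_iff by (intro extensionalityI[of _ "Arr A"]) auto
  then show ?thesis using assms unfolding hom_Cat_over_iff by metis
qed

lemma Comp_Cat_over:
  assumes "u \<in> hom_set (Cat_over X) A B" "v \<in> hom_set (Cat_over X) B C"
  shows Comp_Cat_over_hom: "Comp (Cat_over X) v u \<in> hom_set (Cat_over X) A C"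
    and arr_map_Comp_Cat_over:
      "f \<in> Arr A \<Longrightarrow> arr_map (Comp (Cat_over X) v u) f = arr_map v (arr_map u f)"
proof -
  have u: "u = (A, B, arr_map u)" and v: "v = (B, C, arr_map v)"
    using assms unfolding hom_Cat_over_iff by auto
  have vu: "Comp (Cat_over X) v u = (A, C, compose (Arr A) (arr_map v) (arr_map u))"
    by (subst u, subst v) (simp add: Cat_over_def)
  have "is_functor A C (\<lambda>x. x) (\<lambda>f. arr_map v (arr_map u f))"
    using assms is_functor_comp[of A B "\<lambda>x. x" "arr_map u" C "\<lambda>x. x" "arr_map v"]
    unfolding hom_Cat_over_iff by simp
  then show "Comp (Cat_over X) v u \<in> hom_set (Cat_over X) A C"
    using assms unfolding vu compose_def
    by (intro hom_Cat_overI) (auto simp: hom_Cat_over_iff)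
  show "f \<in> Arr A \<Longrightarrow> arr_map (Comp (Cat_over X) v u) f = arr_map v (arr_map u f)"
    unfolding vu by (simp add: arr_map_def compose_def)
qed

lemma Ident_Cat_over:
  assumes "A \<in> Obj (Cat_over X)"
  shows Ident_Cat_over_hom: "Ident (Cat_over X) A \<in> hom_set (Cat_over X) A A"
    and arr_map_Ident_Cat_over: "f \<in> Arr A \<Longrightarrow> arr_map (Ident (Cat_over X) A) f = f"
proof -
  have "is_functor A A (\<lambda>x. x) (\<lambda>a. a)"
    using assms by (intro is_functorI) (auto simp: Obj_Cat_over hom_set_iff)
  then show "Ident (Cat_over X) A \<in> hom_set (Cat_over X) A A"
    using assms hom_Cat_overI[of A A "\<lambda>a. a"] by (simp add: Cat_over_def)
  show "f \<in> Arr A \<Longrightarrow> arr_map (Ident (Cat_over X) A) f = f"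
    by (simp add: Cat_over_def arr_map_def)
qed

lemma hom_Obj_Cat_over:
  assumes "u \<in> hom_set (Cat_over X) A B"
  shows "A \<in> Obj (Cat_over X)" "B \<in> Obj (Cat_over X)"
  using hom_Cat_overD[OF assms] by (auto simp: Obj_Cat_over)

lemma category_Cat_over: "category (Cat_over X)"
proof (rule categoryI)
  fix f g assume "f \<in> Arr (Cat_over X)" "g \<in> Arr (Cat_over X)" "Cod (Cat_over X) f = Dom (Cat_over X) g"
  then show "Comp (Cat_over X) g f \<in> hom_set (Cat_over X) (Dom (Cat_over X) f) (Cod (Cat_over X) g)"
    by (metis Arr_Cat_over_hom Comp_Cat_over_hom)
next
  fix f assume f: "f \<in> Arr (Cat_over X)"
  let ?A = "Dom (Cat_over X) f" and ?B = "Cod (Cat_over X) f"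
  have fh: "f \<in> hom_set (Cat_over X) ?A ?B" using f by (rule Arr_Cat_over_hom)
  then show "?A \<in> Obj (Cat_over X)" "?B \<in> Obj (Cat_over X)"
    using hom_Obj_Cat_over by blast+
  note I = Ident_Cat_over[OF this(1)] Ident_Cat_over[OF this(2)]
  show "Comp (Cat_over X) f (Ident (Cat_over X) ?A) = f"
    by (rule hom_Cat_over_eqI[OF Comp_Cat_over_hom[OF I(1) fh] fh])
       (simp add: arr_map_Comp_Cat_over[OF I(1) fh] I)
  show "Comp (Cat_over X) (Ident (Cat_over X) ?B) f = f"
    by (rule hom_Cat_over_eqI[OF Comp_Cat_over_hom[OF fh I(3)] fh])
       (simp add: arr_map_Comp_Cat_over[OF fh I(3)] I arr_map_Arr[OF fh])
next
  fix f g h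
  assume "f \<in> Arr (Cat_over X)" "g \<in> Arr (Cat_over X)" "h \<in> Arr (Cat_over X)"
    "Cod (Cat_over X) f = Dom (Cat_over X) g" "Cod (Cat_over X) g = Dom (Cat_over X) h"
  then obtain A B C D where f: "f \<in> hom_set (Cat_over X) A B" and g: "g \<in> hom_set (Cat_over X) B C"
    and h: "h \<in> hom_set (Cat_over X) C D"
    by (metis Arr_Cat_over_hom)
  note gf = Comp_Cat_over_hom[OF f g] and hg = Comp_Cat_over_hom[OF g h]
  show "Comp (Cat_over X) h (Comp (Cat_over X) g f) = Comp (Cat_over X) (Comp (Cat_over X) h g) f"
    by (rule hom_Cat_over_eqI[OF Comp_Cat_over_hom[OF gf h] Comp_Cat_over_hom[OF f hg]])
       (simp add: arr_map_Comp_Cat_over[OF f g] arr_map_Comp_Cat_over[OF g h]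
          arr_map_Comp_Cat_over[OF gf h] arr_map_Comp_Cat_over[OF f hg] arr_map_Arr[OF f])
qed (auto intro: Ident_Cat_over_hom)

section \<open>Finite limits\<close>

text \<open>
  Limits are built on pairs or families of arrows, which do not live in the universe \<open>'u\<close>;
  \<open>recode\<close> transports such a category along an injection into \<open>'u\<close>.
\<close>

definition recode :: "('a \<Rightarrow> 'b) \<Rightarrow> ('o, 'a) cat \<Rightarrow> ('o, 'b) cat" where
  "recode c M =
     \<lparr> Obj = Obj M,
       Arr = c ` Arr M,
       Dom = (\<lambda>a. Dom M (inv_into (Arr M) c a)),
       Cod = (\<lambda>a. Cod M (inv_into (Arr M) c a)),
       Ident = (\<lambda>x. c (Ident M x)),
       Comp = (\<lambda>b a. c (Comp M (inv_into (Arr M) c b) (inv_into (Arr M) c a))) \<rparr>"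

lemma
  assumes "category M" "inj_on c (Arr M)"
  shows category_recode: "category (recode c M)"
    and is_functor_recode: "is_functor M (recode c M) (\<lambda>x. x) c"
    and is_functor_unrecode: "is_functor (recode c M) M (\<lambda>x. x) (inv_into (Arr M) c)"
proof -
  have [simp]: "inv_into (Arr M) c (c a) = a" if "a \<in> Arr M" for a
    using assms(2) that by simp
  note [simp] = category_simps[OF assms(1)]
  show R: "category (recode c M)"
    by (rule categoryI) (auto simp: recode_def hom_set_iff)
  show "is_functor M (recode c M) (\<lambda>x. x) c"
    by (rule is_functorI[OF assms(1) R]) (auto simp: recode_def hom_set_iff)
  show "is_functor (recode c M) M (\<lambda>x. x) (inv_into (Arr M) c)"
    by (rule is_functorI[OF R assms(1)]) (auto simp: recode_def hom_set_iff)
qed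

section \<open>Coding pairs and finite families in an infinite universe\<close>

lemma ex_inj_prod: "\<exists>c :: 'u::infinite \<times> 'u \<Rightarrow> 'u. inj c"
  using card_of_Times_same_infinite[OF infinite_UNIV, THEN ordIso_imp_ordLeq,
      THEN card_of_ordLeq[THEN iffD2]]
  by auto

text \<open>Induction on \<open>I\<close>: one coordinate is split off and paired with the code of
  the remaining family. For empty \<open>I\<close> there is a single extensional family.\<close>

lemma ex_inj_on_PiE:
  assumes "finite I"
  shows "\<exists>c :: ('i \<Rightarrow> 'u::infinite) \<Rightarrow> 'u. inj_on c (extensional I)"
  using assms
proof (induction I)
  case empty
  then show ?case by (simp add: extensional_empty)
next
  case (insert i I)
  then obtain c :: "('i \<Rightarrow> 'u) \<Rightarrow> 'u" where c: "inj_on c (extensional I)" by blast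
  obtain e :: "'u \<times> 'u \<Rightarrow> 'u" where e: "inj e" using ex_inj_prod by blast
  have "inj_on (\<lambda>f. e (f i, c (restrict f I))) (extensional (insert i I))"
  proof (rule inj_onI)
    fix f g :: "'i \<Rightarrow> 'u"
    assume fg: "f \<in> extensional (insert i I)" "g \<in> extensional (insert i I)"
      and eq: "e (f i, c (restrict f I)) = e (g i, c (restrict g I))"
    then have "f i = g i" "restrict f I = restrict g I"
      using e inj_onD[OF c, of "restrict f I" "restrict g I"] by (auto dest: injD)
    then have "f j = g j" if "j \<in> insert i I" for j
      using that by (metis insertE restrict_apply')
    with fg show "f = g" by (rule extensionalityI)
  qed
  then show ?case by blast
qed

text \<open>
  The components \<open>x\<close> and \<open>y\<close> matter for the empty diagram only, where the family \<open>\<phi>\<close> does not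
  determine the source and the target.
\<close>

definition limit_cat ::
  "'u set \<Rightarrow> ('j, 'k) cat \<Rightarrow> ('j \<Rightarrow> 'u small_cat) \<Rightarrow> ('k \<Rightarrow> 'u io_functor) \<Rightarrow>
    ('u, 'u \<times> 'u \<times> ('j \<Rightarrow> 'u)) cat" where
  "limit_cat X J F\<^sub>0 F\<^sub>1 =
     \<lparr> Obj = X,
       Arr = {(x, y, \<phi>). x \<in> X \<and> y \<in> X \<and> \<phi> \<in> (\<Pi>\<^sub>E j\<in>Obj J. hom_set (F\<^sub>0 j) x y) \<and>
         (\<forall>k\<in>Arr J. arr_map (F\<^sub>1 k) (\<phi> (Dom J k)) = \<phi> (Cod J k))},
       Dom = (\<lambda>(x, y, \<phi>). x),
       Cod = (\<lambda>(x, y, \<phi>). y),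
       Ident = (\<lambda>x. (x, x, \<lambda>j\<in>Obj J. Ident (F\<^sub>0 j) x)),
       Comp = (\<lambda>(y', z, \<psi>) (x, y, \<phi>). (x, z, \<lambda>j\<in>Obj J. Comp (F\<^sub>0 j) (\<psi> j) (\<phi> j))) \<rparr>"

lemma PiE_hom_set_iff:
  "\<phi> \<in> (\<Pi>\<^sub>E j\<in>I. hom_set (A j) x y) \<longleftrightarrow>
     \<phi> \<in> extensional I \<and> (\<forall>j\<in>I. \<phi> j \<in> Arr (A j) \<and> Dom (A j) (\<phi> j) = x \<and> Cod (A j) (\<phi> j) = y)"
  by (auto simp: PiE_def Pi_def hom_set_iff)

context
  fixes X :: "'u set" and J :: "('j, 'k) cat" and F\<^sub>0 F\<^sub>1
  assumes F: "is_functor J (Cat_over X) F\<^sub>0 F\<^sub>1"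
begin

lemma diagram_Obj: "j \<in> Obj J \<Longrightarrow> category (F\<^sub>0 j) \<and> Obj (F\<^sub>0 j) = X"
  using F unfolding is_functor_def by (auto simp: Obj_Cat_over)

lemma diagram_Arr: "k \<in> Arr J \<Longrightarrow> F\<^sub>1 k \<in> hom_set (Cat_over X) (F\<^sub>0 (Dom J k)) (F\<^sub>0 (Cod J k))"
  using F unfolding is_functor_def by auto

lemma diagram_Dom_Cod: "k \<in> Arr J \<Longrightarrow> Dom J k \<in> Obj J \<and> Cod J k \<in> Obj J"
  using F unfolding is_functor_def by (auto simp: category_simps)

text \<open>Matching families are closed under identities and composition because each
  \<open>F\<^sub>1 k\<close> is a functor that fixes objects.\<close>

lemma category_limit_cat: "category (limit_cat X J F\<^sub>0 F\<^sub>1)"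
proof -
  note [simp] = diagram_Dom_Cod
  have [simp]: "category (F\<^sub>0 j)" "Obj (F\<^sub>0 j) = X" if "j \<in> Obj J" for j
    using diagram_Obj that by auto
  note [simp] = category_simps
  show ?thesis
  proof (rule categoryI)
    fix x assume "x \<in> Obj (limit_cat X J F\<^sub>0 F\<^sub>1)"
    then show "Ident (limit_cat X J F\<^sub>0 F\<^sub>1) x \<in> hom_set (limit_cat X J F\<^sub>0 F\<^sub>1) x x"
      by (auto simp: limit_cat_def hom_set_iff PiE_hom_set_iff arr_map_Ident[OF diagram_Arr])
  next
    fix f g
    assume "f \<in> Arr (limit_cat X J F\<^sub>0 F\<^sub>1)" "g \<in> Arr (limit_cat X J F\<^sub>0 F\<^sub>1)"
      "Cod (limit_cat X J F\<^sub>0 F\<^sub>1) f = Dom (limit_cat X J F\<^sub>0 F\<^sub>1) g"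
    then show "Comp (limit_cat X J F\<^sub>0 F\<^sub>1) g f \<in>
        hom_set (limit_cat X J F\<^sub>0 F\<^sub>1) (Dom (limit_cat X J F\<^sub>0 F\<^sub>1) f) (Cod (limit_cat X J F\<^sub>0 F\<^sub>1) g)"
      by (auto simp: limit_cat_def hom_set_iff PiE_hom_set_iff arr_map_Comp[OF diagram_Arr])
  qed (auto simp: limit_cat_def PiE_hom_set_iff intro!: extensionalityI[of _ "Obj J"])
qed

lemma is_functor_limit_cat_proj:
  assumes "j \<in> Obj J"
  shows "is_functor (limit_cat X J F\<^sub>0 F\<^sub>1) (F\<^sub>0 j) (\<lambda>x. x) (\<lambda>(x, y, \<phi>). \<phi> j)"
  using diagram_Obj[OF assms] assms category_limit_cat
  by (intro is_functorI) (auto simp: limit_cat_def PiE_hom_set_iff hom_set_iff)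

text \<open>The limit is the usual category of matching families. The size of the diagram matters
  through the coding \<open>c\<close>, which must embed the families into the universe.\<close>

lemma ex_limit_Cat_over:
  fixes c :: "'u \<times> 'u \<times> ('j \<Rightarrow> 'u) \<Rightarrow> 'u"
  assumes c: "inj_on c (UNIV \<times> UNIV \<times> extensional (Obj J))"
  shows "\<exists>L p. is_limit J (Cat_over X) F\<^sub>0 F\<^sub>1 L p"
proof -
  let ?M = "limit_cat X J F\<^sub>0 F\<^sub>1"
  let ?L = "recode c ?M"
  let ?i = "inv_into (Arr ?M) c"
  let ?f = "\<lambda>j a. (\<lambda>(x, y, \<phi>). \<phi> j) (?i a)"
  let ?p = "\<lambda>j. (?L, F\<^sub>0 j, restrict (?f j) (Arr ?L))"
  have cM: "inj_on c (Arr ?M)"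
    by (rule inj_on_subset[OF c]) (auto simp: limit_cat_def PiE_def)
  have [simp]: "?i (c a) = a" if "a \<in> Arr ?M" for a
    using cM that by simp
  have LX: "Obj ?L = X" by (simp add: recode_def limit_cat_def)
  have catL: "category ?L" by (rule category_recode[OF category_limit_cat cM])
  have ArrL: "Arr ?L = c ` Arr ?M" by (simp add: recode_def)
  have p: "?p j \<in> hom_set (Cat_over X) ?L (F\<^sub>0 j)" if "j \<in> Obj J" for j
    using is_functor_comp[OF is_functor_unrecode[OF category_limit_cat cM]
        is_functor_limit_cat_proj[OF that]] diagram_Obj[OF that] LX
    by (intro hom_Cat_overI) auto
  have app: "arr_map (?p j) (c a) = snd (snd a) j" if "a \<in> Arr ?M" for j a
    using that by (simp add: arr_map_def ArrL split: prod.split)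
  have cone: "is_cone J (Cat_over X) F\<^sub>0 F\<^sub>1 ?L ?p"
    unfolding is_cone_def
  proof (intro conjI ballI)
    show "?L \<in> Obj (Cat_over X)" using catL LX by (simp add: Obj_Cat_over)
    fix k assume k: "k \<in> Arr J"
    note pd = p[OF conjunct1[OF diagram_Dom_Cod[OF k]]]
      and pc = p[OF conjunct2[OF diagram_Dom_Cod[OF k]]]
    show "Comp (Cat_over X) (F\<^sub>1 k) (?p (Dom J k)) = ?p (Cod J k)"
    proof (rule hom_Cat_over_eqI[OF Comp_Cat_over_hom[OF pd diagram_Arr[OF k]] pc])
      fix a assume a: "a \<in> Arr ?L"
      then obtain b where b: "b \<in> Arr ?M" "a = c b" unfolding ArrL by auto
      have "arr_map (Comp (Cat_over X) (F\<^sub>1 k) (?p (Dom J k))) a =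
          arr_map (F\<^sub>1 k) (arr_map (?p (Dom J k)) (c b))"
        using arr_map_Comp_Cat_over[OF pd diagram_Arr[OF k] a] b(2) by simp
      also have "\<dots> = arr_map (F\<^sub>1 k) (snd (snd b) (Dom J k))"
        by (simp only: app[OF b(1)])
      also have "\<dots> = snd (snd b) (Cod J k)"
        using k b(1) by (auto simp: limit_cat_def)
      also have "\<dots> = arr_map (?p (Cod J k)) a"
        by (simp only: app[OF b(1)] b(2))
      finally show "arr_map (Comp (Cat_over X) (F\<^sub>1 k) (?p (Dom J k))) a =
          arr_map (?p (Cod J k)) a" .
    qed
  qed (use p in auto)
  have "\<exists>!h. h \<in> hom_set (Cat_over X) Z ?L \<and> (\<forall>j\<in>Obj J. Comp (Cat_over X) (?p j) h = q j)"
    if q: "is_cone J (Cat_over X) F\<^sub>0 F\<^sub>1 Z q" for Z q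
  proof -
    have Z: "category Z" "Obj Z = X"
      using q by (auto simp: is_cone_def Obj_Cat_over)
    have qj: "q j \<in> hom_set (Cat_over X) Z (F\<^sub>0 j)" if "j \<in> Obj J" for j
      using q that by (auto simp: is_cone_def)
    have qk: "arr_map (F\<^sub>1 k) (arr_map (q (Dom J k)) z) = arr_map (q (Cod J k)) z"
      if k: "k \<in> Arr J" and z: "z \<in> Arr Z" for k z
    proof -
      have "Comp (Cat_over X) (F\<^sub>1 k) (q (Dom J k)) = q (Cod J k)"
        using q k by (simp add: is_cone_def)
      then show ?thesis
        using arr_map_Comp_Cat_over[OF qj diagram_Arr[OF k] z] diagram_Dom_Cod[OF k] by metis
    qed
    \<comment> \<open>The induced functor is forced: its family collects the values of the
      \<open>q j\<close>, and its endpoints are those of \<open>z\<close> since objects are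
      fixed.\<close>
    let ?g = "\<lambda>z. (Dom Z z, Cod Z z, \<lambda>j\<in>Obj J. arr_map (q j) z)"
    have g: "?g z \<in> Arr ?M" if "z \<in> Arr Z" for z
      using that Z qk diagram_Dom_Cod
      by (auto simp: limit_cat_def category_simps PiE_hom_set_iff arr_map_Arr[OF qj]
          Dom_arr_map[OF qj] Cod_arr_map[OF qj])
    have "is_functor Z ?M (\<lambda>x. x) ?g"
      using g Z
      by (intro is_functorI category_limit_cat)
        (auto simp: limit_cat_def category_simps hom_set_iff arr_map_Ident[OF qj]
          arr_map_Comp[OF qj])
    then have "is_functor Z ?L (\<lambda>x. x) (\<lambda>z. c (?g z))"
      by (rule is_functor_comp[OF _ is_functor_recode[OF category_limit_cat cM]])
    then have h: "(Z, ?L, restrict (\<lambda>z. c (?g z)) (Arr Z)) \<in> hom_set (Cat_over X) Z ?L"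
      (is "?h \<in> _")
      by (rule hom_Cat_overI) (use Z LX in auto)
    have "Comp (Cat_over X) (?p j) ?h = q j" if j: "j \<in> Obj J" for j
    proof (rule hom_Cat_over_eqI[OF Comp_Cat_over_hom[OF h p[OF j]] qj[OF j]])
      fix z assume z: "z \<in> Arr Z"
      have "arr_map ?h z = c (?g z)" using z by (simp add: arr_map_def)
      then show "arr_map (Comp (Cat_over X) (?p j) ?h) z = arr_map (q j) z"
        unfolding arr_map_Comp_Cat_over[OF h p[OF j] z] using j by (simp add: app[OF g[OF z]])
    qed
    moreover have "h' = ?h"
      if h': "h' \<in> hom_set (Cat_over X) Z ?L"
        and e: "\<forall>j\<in>Obj J. Comp (Cat_over X) (?p j) h' = q j" for h'
    proof (rule hom_Cat_over_eqI[OF h' h])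
      fix z assume z: "z \<in> Arr Z"
      obtain a where a: "a \<in> Arr ?M" "arr_map h' z = c a"
        using arr_map_Arr[OF h' z] unfolding ArrL by auto
      have aj: "snd (snd a) j = arr_map (q j) z" if j: "j \<in> Obj J" for j
        using arr_map_Comp_Cat_over[OF h' p[OF j] z] e j app[OF a(1), of j] a(2) by simp
      \<comment> \<open>The projections see the family in \<open>a\<close>; its endpoints are
        recovered because \<open>h'\<close> fixes objects. For the empty diagram the endpoints are
        all there is.\<close>
      have "Dom ?M a = Dom Z z" "Cod ?M a = Cod Z z"
        using Dom_arr_map[OF h' z] Cod_arr_map[OF h' z] a by (auto simp: recode_def)
      moreover have "snd (snd a) = (\<lambda>j\<in>Obj J. arr_map (q j) z)"
        using a(1) aj
        by (intro extensionalityI[of _ "Obj J"]) (auto simp: limit_cat_def PiE_def)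
      ultimately have "a = ?g z" by (cases a) (simp add: limit_cat_def)
      then show "arr_map h' z = arr_map ?h z" using a z by (simp add: arr_map_def)
    qed
    ultimately show ?thesis using h by blast
  qed
  with cone show ?thesis unfolding is_limit_def by blast
qed

end

lemma finitely_complete_Cat_over:
  fixes X :: "'u::infinite set"
  shows "finitely_complete (Cat_over X)"
  unfolding finitely_complete_def
proof (intro conjI allI impI category_Cat_over)
  fix J :: "(nat, nat) cat" and F\<^sub>0 F\<^sub>1
  assume J: "finite (Obj J) \<and> finite (Arr J) \<and> is_functor J (Cat_over X) F\<^sub>0 F\<^sub>1"
  obtain c :: "(nat \<Rightarrow> 'u) \<Rightarrow> 'u" where c: "inj_on c (extensional (Obj J))"
    using ex_inj_on_PiE J by blast
  obtain e :: "'u \<times> 'u \<Rightarrow> 'u" where e: "inj e" using ex_inj_prod by blast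
  \<comment> \<open>Nested pairing codes a triple, with the endpoints kept beside the code of the
    family.\<close>
  have "inj_on (\<lambda>(x, y, \<phi>). e (x, e (y, c \<phi>))) (UNIV \<times> UNIV \<times> extensional (Obj J))"
    by (rule inj_onI) (auto simp: inj_eq[OF e] inj_on_eq_iff[OF c])
  then show "\<exists>L p. is_limit J (Cat_over X) F\<^sub>0 F\<^sub>1 L p"
    using ex_limit_Cat_over J by blast
qed

section \<open>Spans and relations\<close>

text \<open>Such an \<open>R\<close> is the set of arrows of a subcategory, with all objects, of the
  product of \<open>A\<close> and \<open>B\<close> in the fiber over their common set of objects;
  the arrows of that product are the parallel pairs.\<close>

definition compatible_rel :: "('o, 'a) cat \<Rightarrow> ('o, 'b) cat \<Rightarrow> ('a \<times> 'b) set \<Rightarrow> bool" where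
  "compatible_rel A B R \<longleftrightarrow>
     (\<forall>(f, g)\<in>R. f \<in> Arr A \<and> g \<in> Arr B \<and> Dom A f = Dom B g \<and> Cod A f = Cod B g) \<and>
     (\<forall>x\<in>Obj A. (Ident A x, Ident B x) \<in> R) \<and>
     (\<forall>(f, g)\<in>R. \<forall>(f', g')\<in>R. Cod A f = Dom A f' \<longrightarrow> (Comp A f' f, Comp B g' g) \<in> R)"

definition rel_cat :: "('o, 'a) cat \<Rightarrow> ('o, 'b) cat \<Rightarrow> ('a \<times> 'b) set \<Rightarrow> ('o, 'a \<times> 'b) cat" where
  "rel_cat A B R =
     \<lparr> Obj = Obj A, Arr = R, Dom = (\<lambda>(f, g). Dom A f), Cod = (\<lambda>(f, g). Cod A f),
       Ident = (\<lambda>x. (Ident A x, Ident B x)),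
       Comp = (\<lambda>(f', g') (f, g). (Comp A f' f, Comp B g' g)) \<rparr>"

lemma
  assumes "category A" "category B" "Obj A = Obj B" "compatible_rel A B R"
  shows category_rel_cat: "category (rel_cat A B R)"
    and is_functor_rel_cat_fst: "is_functor (rel_cat A B R) A (\<lambda>x. x) fst"
    and is_functor_rel_cat_snd: "is_functor (rel_cat A B R) B (\<lambda>x. x) snd"
proof -
  have R: "fst a \<in> Arr A" "snd a \<in> Arr B" "Dom B (snd a) = Dom A (fst a)"
    "Cod B (snd a) = Cod A (fst a)" if "a \<in> R" for a
    using assms(4) that unfolding compatible_rel_def by auto
  have RI: "(Ident A x, Ident B x) \<in> R" if "x \<in> Obj B" for x
    using assms that unfolding compatible_rel_def by auto
  have RC: "(Comp A (fst b) (fst a), Comp B (snd b) (snd a)) \<in> R"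
    if "a \<in> R" "b \<in> R" "Cod A (fst a) = Dom A (fst b)" for a b
    using assms(4) that unfolding compatible_rel_def by (auto simp: split_beta)
  note [simp] = category_simps[OF assms(1)] category_simps[OF assms(2)] assms(1-3) R RI RC
  have RO: "Dom A (fst a) \<in> Obj B" "Cod A (fst a) \<in> Obj B" if "a \<in> R" for a
    using category_Dom[OF assms(1)] category_Cod[OF assms(1)] R(1)[OF that] assms(3) by auto
  note [simp] = RO
  show c: "category (rel_cat A B R)"
    by (rule categoryI) (simp_all add: rel_cat_def hom_set_iff split_beta)
  show "is_functor (rel_cat A B R) A (\<lambda>x. x) fst"
    by (rule is_functorI[OF c]) (simp_all add: rel_cat_def hom_set_iff split_beta)
  show "is_functor (rel_cat A B R) B (\<lambda>x. x) snd"
    by (rule is_functorI[OF c]) (simp_all add: rel_cat_def hom_set_iff split_beta)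
qed

text \<open>A tabulation in the sense of allegories. Products, pullbacks and internal relations are
  instances for different \<open>R\<close>, so that one lifting lemma serves them all. Compatibility
  of \<open>R\<close> is a consequence, by \<open>tabulates_compatible_rel\<close>.\<close>

definition tabulates ::
  "'u set \<Rightarrow> 'u small_cat \<Rightarrow> 'u io_functor \<Rightarrow> 'u io_functor \<Rightarrow> 'u small_cat \<Rightarrow> 'u small_cat \<Rightarrow>
    ('u \<times> 'u) set \<Rightarrow> bool" where
  "tabulates X P p q A B R \<longleftrightarrow>
     p \<in> hom_set (Cat_over X) P A \<and> q \<in> hom_set (Cat_over X) P B \<and>
     bij_betw (\<lambda>v. (arr_map p v, arr_map q v)) (Arr P) R"

lemma tabulatesD:
  assumes "tabulates X P p q A B R"
  shows tabulates_fst: "p \<in> hom_set (Cat_over X) P A"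
    and tabulates_snd: "q \<in> hom_set (Cat_over X) P B"
    and tabulates_mem: "v \<in> Arr P \<Longrightarrow> (arr_map p v, arr_map q v) \<in> R"
    and tabulates_ex: "(a, b) \<in> R \<Longrightarrow> \<exists>v\<in>Arr P. arr_map p v = a \<and> arr_map q v = b"
    and tabulates_inj: "v \<in> Arr P \<Longrightarrow> w \<in> Arr P \<Longrightarrow> arr_map p v = arr_map p w \<Longrightarrow>
      arr_map q v = arr_map q w \<Longrightarrow> v = w"
proof -
  have "inj_on (\<lambda>v. (arr_map p v, arr_map q v)) (Arr P)"
    and R: "R = (\<lambda>v. (arr_map p v, arr_map q v)) ` Arr P"
    and "p \<in> hom_set (Cat_over X) P A" "q \<in> hom_set (Cat_over X) P B"
    using assms unfolding tabulates_def bij_betw_def by simp_all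
  then show "p \<in> hom_set (Cat_over X) P A" "q \<in> hom_set (Cat_over X) P B"
    "v \<in> Arr P \<Longrightarrow> w \<in> Arr P \<Longrightarrow> arr_map p v = arr_map p w \<Longrightarrow>
      arr_map q v = arr_map q w \<Longrightarrow> v = w"
    by (simp_all add: inj_on_def)
  show "v \<in> Arr P \<Longrightarrow> (arr_map p v, arr_map q v) \<in> R"
    unfolding R by (rule imageI)
  show "(a, b) \<in> R \<Longrightarrow> \<exists>v\<in>Arr P. arr_map p v = a \<and> arr_map q v = b"
    unfolding R by blast
qed

lemma tabulatesI:
  assumes "p \<in> hom_set (Cat_over X) P A" "q \<in> hom_set (Cat_over X) P B"
    and "\<And>v. v \<in> Arr P \<Longrightarrow> (arr_map p v, arr_map q v) \<in> R"
    and "\<And>a b. (a, b) \<in> R \<Longrightarrow> \<exists>v\<in>Arr P. arr_map p v = a \<and> arr_map q v = b"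
    and "\<And>v w. v \<in> Arr P \<Longrightarrow> w \<in> Arr P \<Longrightarrow> arr_map p v = arr_map p w \<Longrightarrow>
      arr_map q v = arr_map q w \<Longrightarrow> v = w"
  shows "tabulates X P p q A B R"
proof -
  have "(\<lambda>v. (arr_map p v, arr_map q v)) ` Arr P = R"
    using assms(3,4) by fastforce
  moreover have "inj_on (\<lambda>v. (arr_map p v, arr_map q v)) (Arr P)"
    using assms(5) by (intro inj_onI) simp
  ultimately show ?thesis
    using assms(1,2) unfolding tabulates_def bij_betw_def by simp
qed

text \<open>The relation itself, with componentwise structure, is made into a category over
  \<open>X\<close> and coded along an injection of pairs into the universe.\<close>

lemma ex_tabulates:
  fixes X :: "'u::infinite set"
  assumes "A \<in> Obj (Cat_over X)" "B \<in> Obj (Cat_over X)" "compatible_rel A B R"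
  obtains P p q where "tabulates X P p q A B R"
proof -
  obtain c :: "'u \<times> 'u \<Rightarrow> 'u" where "inj c" using ex_inj_prod by blast
  then have cR: "inj_on c (Arr (rel_cat A B R))" by (rule inj_on_subset) simp
  have AB: "category A" "category B" "Obj A = Obj B" "Obj A = X" "Obj B = X"
    using assms by (auto simp: Obj_Cat_over)
  let ?P = "recode c (rel_cat A B R)"
  let ?i = "inv_into (Arr (rel_cat A B R)) c"
  note C = category_rel_cat[OF AB(1-3) assms(3)]
  have P: "Obj ?P = X" "Arr ?P = c ` R" by (simp_all add: recode_def rel_cat_def AB)
  note I = is_functor_comp[OF is_functor_unrecode[OF C cR]]
  have p: "(?P, A, restrict (\<lambda>a. fst (?i a)) (Arr ?P)) \<in> hom_set (Cat_over X) ?P A"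
    using I[OF is_functor_rel_cat_fst[OF AB(1-3) assms(3)]] P AB by (intro hom_Cat_overI) auto
  have q: "(?P, B, restrict (\<lambda>a. snd (?i a)) (Arr ?P)) \<in> hom_set (Cat_over X) ?P B"
    using I[OF is_functor_rel_cat_snd[OF AB(1-3) assms(3)]] P AB by (intro hom_Cat_overI) auto
  have i: "?i (c a) = a" if "a \<in> R" for a
    using cR that by (simp add: rel_cat_def)
  have pq: "arr_map (?P, A, restrict (\<lambda>a. fst (?i a)) (Arr ?P)) (c a) = fst a"
    "arr_map (?P, B, restrict (\<lambda>a. snd (?i a)) (Arr ?P)) (c a) = snd a" if "a \<in> R" for a
    using that i by (simp_all add: arr_map_def P)
  show ?thesis
  proof (rule that, rule tabulatesI[OF p q], unfold P(2))
    fix a b assume "(a, b) \<in> R"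
    then show "\<exists>v\<in>c ` R. arr_map (?P, A, restrict (\<lambda>a. fst (?i a)) (c ` R)) v = a \<and>
        arr_map (?P, B, restrict (\<lambda>a. snd (?i a)) (c ` R)) v = b"
      using pq unfolding P(2) by (intro bexI[of _ "c (a, b)"]) auto
  qed (use pq in \<open>auto simp: P(2) prod_eq_iff\<close>)
qed

text \<open>Each pair \<open>(arr_map a z, arr_map b z)\<close> has exactly one preimage in
  \<open>P\<close>. Choosing it is automatically functorial, as the two sides of each functor law
  have equal images under \<open>p\<close> and under \<open>q\<close>.\<close>

lemma tabulates_lift:
  assumes T: "tabulates X P p q A B R"
    and a: "a \<in> hom_set (Cat_over X) Z A" and b: "b \<in> hom_set (Cat_over X) Z B"
    and R: "\<And>z. z \<in> Arr Z \<Longrightarrow> (arr_map a z, arr_map b z) \<in> R"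
  shows "\<exists>!h. h \<in> hom_set (Cat_over X) Z P \<and>
    Comp (Cat_over X) p h = a \<and> Comp (Cat_over X) q h = b"
proof -
  note p = tabulates_fst[OF T] and q = tabulates_snd[OF T]
  have "\<forall>z\<in>Arr Z. \<exists>v. v \<in> Arr P \<and> arr_map p v = arr_map a z \<and> arr_map q v = arr_map b z"
    using tabulates_ex[OF T R] by blast
  from bchoice[OF this] obtain g where g: "\<And>z. z \<in> Arr Z \<Longrightarrow> g z \<in> Arr P"
    "\<And>z. z \<in> Arr Z \<Longrightarrow> arr_map p (g z) = arr_map a z"
    "\<And>z. z \<in> Arr Z \<Longrightarrow> arr_map q (g z) = arr_map b z"
    by blast
  note catZ = category_simps[OF hom_category_dom[OF a]]
  note catP = category_simps[OF hom_category_dom[OF p]]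
  have D: "Dom P (g z) = Dom Z z" "Cod P (g z) = Cod Z z" if "z \<in> Arr Z" for z
    using g[OF that] Dom_arr_map[OF p g(1)[OF that]] Dom_arr_map[OF a that]
      Cod_arr_map[OF p g(1)[OF that]] Cod_arr_map[OF a that] by simp_all
  have X: "Obj Z = X" "Obj P = X" using hom_Obj_dom[OF a] hom_Obj_dom[OF p] .
  have "is_functor Z P (\<lambda>x. x) g"
  proof (rule is_functorI)
    fix x assume x: "x \<in> Obj Z"
    show "g (Ident Z x) = Ident P x"
      by (rule tabulates_inj[OF T])
        (use x X in \<open>simp_all add: catZ catP g arr_map_Ident[OF p] arr_map_Ident[OF q]
          arr_map_Ident[OF a] arr_map_Ident[OF b]\<close>)
  next
    fix f f' assume f: "f \<in> Arr Z" "f' \<in> Arr Z" "Cod Z f = Dom Z f'"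
    show "g (Comp Z f' f) = Comp P (g f') (g f)"
      by (rule tabulates_inj[OF T])
        (use f in \<open>simp_all add: catZ catP g D arr_map_Comp[OF p] arr_map_Comp[OF q]
          arr_map_Comp[OF a] arr_map_Comp[OF b]\<close>)
  qed (use X hom_category_dom[OF a] hom_category_dom[OF p] in \<open>auto simp: hom_set_iff g D\<close>)
  then have h: "(Z, P, restrict g (Arr Z)) \<in> hom_set (Cat_over X) Z P" (is "?h \<in> _")
    using X by (rule hom_Cat_overI)
  have hz: "arr_map ?h z = g z" if "z \<in> Arr Z" for z
    using that by (simp add: arr_map_def)
  have "Comp (Cat_over X) p ?h = a"
    by (rule hom_Cat_over_eqI[OF Comp_Cat_over_hom[OF h p] a])
      (simp add: arr_map_Comp_Cat_over[OF h p] hz g)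
  moreover have "Comp (Cat_over X) q ?h = b"
    by (rule hom_Cat_over_eqI[OF Comp_Cat_over_hom[OF h q] b])
      (simp add: arr_map_Comp_Cat_over[OF h q] hz g)
  moreover have "h' = ?h"
    if h': "h' \<in> hom_set (Cat_over X) Z P"
      and e: "Comp (Cat_over X) p h' = a" "Comp (Cat_over X) q h' = b" for h'
  proof (rule hom_Cat_over_eqI[OF h' h])
    fix z assume z: "z \<in> Arr Z"
    show "arr_map h' z = arr_map ?h z"
      by (rule tabulates_inj[OF T])
        (use arr_map_Comp_Cat_over[OF h' p z] arr_map_Comp_Cat_over[OF h' q z] in
          \<open>simp_all add: z hz g e arr_map_Arr[OF h']\<close>)
  qed
  ultimately show ?thesis using h by blast
qed

lemma compatible_relI:
  assumes "\<And>f g. (f, g) \<in> R \<Longrightarrow> f \<in> Arr A \<and> g \<in> Arr B \<and> Dom A f = Dom B g \<and> Cod A f = Cod B g"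
    and "\<And>x. x \<in> Obj A \<Longrightarrow> (Ident A x, Ident B x) \<in> R"
    and "\<And>f g f' g'. (f, g) \<in> R \<Longrightarrow> (f', g') \<in> R \<Longrightarrow> Cod A f = Dom A f' \<Longrightarrow>
      (Comp A f' f, Comp B g' g) \<in> R"
  shows "compatible_rel A B R"
  using assms unfolding compatible_rel_def by auto

lemma compatible_relD:
  assumes "compatible_rel A B R"
  shows "(f, g) \<in> R \<Longrightarrow> f \<in> Arr A \<and> g \<in> Arr B \<and> Dom A f = Dom B g \<and> Cod A f = Cod B g"
    and "x \<in> Obj A \<Longrightarrow> (Ident A x, Ident B x) \<in> R"
    and "(f, g) \<in> R \<Longrightarrow> (f', g') \<in> R \<Longrightarrow> Cod A f = Dom A f' \<Longrightarrow>
      (Comp A f' f, Comp B g' g) \<in> R"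
  using assms unfolding compatible_rel_def by auto

section \<open>Products and equalizers as compatible relations\<close>

definition parallel :: "('o, 'a) cat \<Rightarrow> ('o, 'b) cat \<Rightarrow> ('a \<times> 'b) set" where
  "parallel A B = {(f, g). f \<in> Arr A \<and> g \<in> Arr B \<and> Dom A f = Dom B g \<and> Cod A f = Cod B g}"

lemma parallel_iff:
  "(f, g) \<in> parallel A B \<longleftrightarrow> f \<in> Arr A \<and> g \<in> Arr B \<and> Dom A f = Dom B g \<and> Cod A f = Cod B g"
  by (simp add: parallel_def)

lemma compatible_rel_parallel:
  assumes "category A" "category B" "Obj A = Obj B"
  shows "compatible_rel A B (parallel A B)"
  using assms by (intro compatible_relI) (auto simp: parallel_iff category_simps)

text \<open>Functors preserve identities and composition, so an equation between two of them cuts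
  out a compatible subset. Iterated, this yields the joint kernel pair of two functors; applied to
  \<open>parallel A B\<close>, it yields the pullback.\<close>

lemma compatible_rel_equalizer:
  assumes f: "f \<in> hom_set (Cat_over X) A C" and g: "g \<in> hom_set (Cat_over X) B C"
    and R: "compatible_rel A B R"
  shows "compatible_rel A B {(a, b) \<in> R. arr_map f a = arr_map g b}"
proof (rule compatible_relI)
  fix a b a' b'
  assume "(a, b) \<in> {(a, b) \<in> R. arr_map f a = arr_map g b}"
    "(a', b') \<in> {(a, b) \<in> R. arr_map f a = arr_map g b}" and c: "Cod A a = Dom A a'"
  then have ab: "(a, b) \<in> R" "(a', b') \<in> R" "arr_map f a = arr_map g b" "arr_map f a' = arr_map g b'"
    by auto
  moreover have "a \<in> Arr A" "a' \<in> Arr A" "b \<in> Arr B" "b' \<in> Arr B" "Cod B b = Dom B b'"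
    using compatible_relD(1)[OF R] ab(1,2) c by metis+
  ultimately show "(Comp A a' a, Comp B b' b) \<in> {(a, b) \<in> R. arr_map f a = arr_map g b}"
    using c compatible_relD(3)[OF R] by (simp add: arr_map_Comp[OF f] arr_map_Comp[OF g])
next
  fix x assume "x \<in> Obj A"
  then show "(Ident A x, Ident B x) \<in> {(a, b) \<in> R. arr_map f a = arr_map g b}"
    using hom_Obj_dom[OF f] compatible_relD(2)[OF R]
    by (simp add: arr_map_Ident[OF f] arr_map_Ident[OF g])
qed (use compatible_relD(1)[OF R] in auto)

text \<open>
  Joint monicity is tested on the two projections of the pairs of arrows identified by \<open>p\<close> and \<open>q\<close>.
\<close>

lemma jointly_monic_inj:
  fixes X :: "'u::infinite set"
  assumes p: "p \<in> hom_set (Cat_over X) P A" and q: "q \<in> hom_set (Cat_over X) P B"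
    and monic: "\<And>Z f g. f \<in> hom_set (Cat_over X) Z P \<Longrightarrow> g \<in> hom_set (Cat_over X) Z P \<Longrightarrow>
      Comp (Cat_over X) p f = Comp (Cat_over X) p g \<Longrightarrow>
      Comp (Cat_over X) q f = Comp (Cat_over X) q g \<Longrightarrow> f = g"
    and v: "v \<in> Arr P" "w \<in> Arr P" "arr_map p v = arr_map p w" "arr_map q v = arr_map q w"
  shows "v = w"
proof -
  note P = hom_category_dom[OF p]
  define R where "R = {(a, b) \<in> {(a, b) \<in> parallel P P. arr_map p a = arr_map p b}.
    arr_map q a = arr_map q b}"
  have "compatible_rel P P R"
    unfolding R_def
    by (intro compatible_rel_equalizer[OF q q] compatible_rel_equalizer[OF p p]
        compatible_rel_parallel P refl)
  then obtain N m n where T: "tabulates X N m n P P R"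
    using ex_tabulates hom_Obj_Cat_over(1)[OF p] by metis
  note m = tabulates_fst[OF T] and n = tabulates_snd[OF T]
  have R: "arr_map p (arr_map m z) = arr_map p (arr_map n z)"
    "arr_map q (arr_map m z) = arr_map q (arr_map n z)" if "z \<in> Arr N" for z
    using tabulates_mem[OF T that] by (auto simp: R_def)
  have "m = n"
  proof (rule monic[OF m n])
    show "Comp (Cat_over X) p m = Comp (Cat_over X) p n"
      by (rule hom_Cat_over_eqI[OF Comp_Cat_over_hom[OF m p] Comp_Cat_over_hom[OF n p]])
        (simp add: arr_map_Comp_Cat_over[OF m p] arr_map_Comp_Cat_over[OF n p] R)
    show "Comp (Cat_over X) q m = Comp (Cat_over X) q n"
      by (rule hom_Cat_over_eqI[OF Comp_Cat_over_hom[OF m q] Comp_Cat_over_hom[OF n q]])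
        (simp add: arr_map_Comp_Cat_over[OF m q] arr_map_Comp_Cat_over[OF n q] R)
  qed
  \<comment> \<open>Arrows identified by \<open>p\<close> are parallel, as \<open>p\<close> fixes
    objects. The pair is then hit by some arrow of \<open>N\<close>, on which \<open>m\<close> and
    \<open>n\<close> agree.\<close>
  moreover have "(v, w) \<in> R"
    using v Dom_arr_map[OF p v(1)] Dom_arr_map[OF p v(2)]
      Cod_arr_map[OF p v(1)] Cod_arr_map[OF p v(2)] by (simp add: R_def parallel_iff)
  ultimately show "v = w" using tabulates_ex[OF T] by blast
qed

text \<open>Converse of \<open>tabulates_lift\<close>. Lifting a tabulation of \<open>R\<close>
  through \<open>P\<close> shows that every pair of \<open>R\<close> is hit; uniqueness of lifts
  makes the span jointly monic, hence jointly injective by \<open>jointly_monic_inj\<close>.\<close>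

lemma universal_tabulates:
  fixes X :: "'u::infinite set"
  assumes p: "p \<in> hom_set (Cat_over X) P A" and q: "q \<in> hom_set (Cat_over X) P B"
    and R: "compatible_rel A B R"
    and mem: "\<And>v. v \<in> Arr P \<Longrightarrow> (arr_map p v, arr_map q v) \<in> R"
    and univ: "\<And>Z a b. a \<in> hom_set (Cat_over X) Z A \<Longrightarrow> b \<in> hom_set (Cat_over X) Z B \<Longrightarrow>
      (\<And>z. z \<in> Arr Z \<Longrightarrow> (arr_map a z, arr_map b z) \<in> R) \<Longrightarrow>
      \<exists>!h. h \<in> hom_set (Cat_over X) Z P \<and> Comp (Cat_over X) p h = a \<and> Comp (Cat_over X) q h = b"
  shows "tabulates X P p q A B R"
proof (rule tabulatesI[OF p q mem])
  fix a b assume ab: "(a, b) \<in> R"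
  obtain N m n where T: "tabulates X N m n A B R"
    using ex_tabulates R hom_Obj_Cat_over(2)[OF p] hom_Obj_Cat_over(2)[OF q] by metis
  obtain h where h: "h \<in> hom_set (Cat_over X) N P"
    "Comp (Cat_over X) p h = m" "Comp (Cat_over X) q h = n"
    using univ[OF tabulatesD(1,2)[OF T] tabulates_mem[OF T]] by blast
  obtain z where z: "z \<in> Arr N" "arr_map m z = a" "arr_map n z = b"
    using tabulates_ex[OF T ab] by blast
  show "\<exists>v\<in>Arr P. arr_map p v = a \<and> arr_map q v = b"
    using arr_map_Arr[OF h(1) z(1)] arr_map_Comp_Cat_over[OF h(1) p z(1)]
      arr_map_Comp_Cat_over[OF h(1) q z(1)] h z by metis
next
  fix v w assume v: "v \<in> Arr P" "w \<in> Arr P" "arr_map p v = arr_map p w" "arr_map q v = arr_map q w"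
  show "v = w"
  proof (rule jointly_monic_inj[OF p q _ v])
    fix Z f g
    assume f: "f \<in> hom_set (Cat_over X) Z P" and g: "g \<in> hom_set (Cat_over X) Z P"
      and e: "Comp (Cat_over X) p f = Comp (Cat_over X) p g"
        "Comp (Cat_over X) q f = Comp (Cat_over X) q g"
    have "\<exists>!h. h \<in> hom_set (Cat_over X) Z P \<and> Comp (Cat_over X) p h = Comp (Cat_over X) p f \<and>
        Comp (Cat_over X) q h = Comp (Cat_over X) q f"
      by (rule univ[OF Comp_Cat_over_hom[OF f p] Comp_Cat_over_hom[OF f q]])
        (simp add: arr_map_Comp_Cat_over[OF f p] arr_map_Comp_Cat_over[OF f q]
          mem arr_map_Arr[OF f])
    then show "f = g" using f g e by metis
  qed
qed

lemma arr_map_parallel: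
  assumes "a \<in> hom_set (Cat_over X) Z A" "b \<in> hom_set (Cat_over X) Z B" "z \<in> Arr Z"
  shows "(arr_map a z, arr_map b z) \<in> parallel A B"
  using assms by (simp add: parallel_iff arr_map_Arr Dom_arr_map Cod_arr_map)

lemma is_product_iff_tabulates:
  fixes X :: "'u::infinite set"
  shows "is_product (Cat_over X) A B P p q \<longleftrightarrow> tabulates X P p q A B (parallel A B)"
proof
  assume pr: "is_product (Cat_over X) A B P p q"
  then have p: "p \<in> hom_set (Cat_over X) P A" and q: "q \<in> hom_set (Cat_over X) P B"
    unfolding is_product_def by auto
  show "tabulates X P p q A B (parallel A B)"
  proof (rule universal_tabulates[OF p q])
    show "compatible_rel A B (parallel A B)"
      using hom_Obj_Cat_over(2)[OF p] hom_Obj_Cat_over(2)[OF q]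
      by (intro compatible_rel_parallel) (auto simp: Obj_Cat_over)
  qed (use pr arr_map_parallel[OF p q] in \<open>auto simp: is_product_def\<close>)
next
  assume T: "tabulates X P p q A B (parallel A B)"
  show "is_product (Cat_over X) A B P p q"
    unfolding is_product_def
    by (intro conjI allI ballI tabulates_lift[OF T] tabulatesD(1,2)[OF T] arr_map_parallel)
qed

text \<open>Both functors fix objects, so endpoints can be read off the common image. This is why
  the relation that describes a pullback is given by the equation alone.\<close>

lemma parallel_of_arr_map_eq:
  assumes f: "f \<in> hom_set (Cat_over X) A C" and g: "g \<in> hom_set (Cat_over X) B C"
    and "a \<in> Arr A" "b \<in> Arr B" "arr_map f a = arr_map g b"
  shows "(a, b) \<in> parallel A B"
  using assms Dom_arr_map[OF f] Dom_arr_map[OF g] Cod_arr_map[OF f] Cod_arr_map[OF g]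
  by (metis parallel_iff)

lemma Comp_eq_iff:
  assumes a: "a \<in> hom_set (Cat_over X) Z A" and b: "b \<in> hom_set (Cat_over X) Z B"
    and f: "f \<in> hom_set (Cat_over X) A C" and g: "g \<in> hom_set (Cat_over X) B C"
  shows "Comp (Cat_over X) f a = Comp (Cat_over X) g b \<longleftrightarrow>
    (\<forall>z\<in>Arr Z. arr_map f (arr_map a z) = arr_map g (arr_map b z))"
  using hom_Cat_over_eqI[OF Comp_Cat_over_hom[OF a f] Comp_Cat_over_hom[OF b g]]
    arr_map_Comp_Cat_over[OF a f] arr_map_Comp_Cat_over[OF b g] by metis

lemma Comp_eq_iff':
  assumes a: "a \<in> hom_set (Cat_over X) Z A"
    and f: "f \<in> hom_set (Cat_over X) A C" and g: "g \<in> hom_set (Cat_over X) Z C"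
  shows "Comp (Cat_over X) f a = g \<longleftrightarrow> (\<forall>z\<in>Arr Z. arr_map f (arr_map a z) = arr_map g z)"
  using hom_Cat_over_eqI[OF Comp_Cat_over_hom[OF a f] g] arr_map_Comp_Cat_over[OF a f] by metis

lemma is_pullback_iff_tabulates:
  fixes X :: "'u::infinite set"
  assumes f: "f \<in> hom_set (Cat_over X) A C" and g: "g \<in> hom_set (Cat_over X) B C"
  shows "is_pullback (Cat_over X) f g P p q \<longleftrightarrow>
    tabulates X P p q A B {(a, b). a \<in> Arr A \<and> b \<in> Arr B \<and> arr_map f a = arr_map g b}"
    (is "_ \<longleftrightarrow> tabulates X P p q A B ?R")
proof
  note [simp] = hom_Dom[OF f] hom_Dom[OF g]
  assume pb: "is_pullback (Cat_over X) f g P p q"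
  then have p: "p \<in> hom_set (Cat_over X) P A" and q: "q \<in> hom_set (Cat_over X) P B"
    unfolding is_pullback_def by auto
  have c: "Comp (Cat_over X) f p = Comp (Cat_over X) g q"
    using pb unfolding is_pullback_def by blast
  show "tabulates X P p q A B ?R"
  proof (rule universal_tabulates[OF p q])
    have "?R = {(a, b) \<in> parallel A B. arr_map f a = arr_map g b}"
      using parallel_of_arr_map_eq[OF f g] by (auto simp: parallel_iff)
    then show "compatible_rel A B ?R"
      using hom_Obj_Cat_over(1)[OF f] hom_Obj_Cat_over(1)[OF g]
        compatible_rel_equalizer[OF f g compatible_rel_parallel] by (auto simp: Obj_Cat_over)
  next
    fix v assume "v \<in> Arr P"
    then show "(arr_map p v, arr_map q v) \<in> ?R"
      using c unfolding Comp_eq_iff[OF p q f g] by (auto simp: arr_map_Arr[OF p] arr_map_Arr[OF q])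
  next
    fix Z a b
    assume a: "a \<in> hom_set (Cat_over X) Z A" and b: "b \<in> hom_set (Cat_over X) Z B"
      and R: "\<And>z. z \<in> Arr Z \<Longrightarrow> (arr_map a z, arr_map b z) \<in> ?R"
    have "Comp (Cat_over X) f a = Comp (Cat_over X) g b"
      unfolding Comp_eq_iff[OF a b f g] using R by auto
    then show "\<exists>!h. h \<in> hom_set (Cat_over X) Z P \<and> Comp (Cat_over X) p h = a \<and>
        Comp (Cat_over X) q h = b"
      using pb a b unfolding is_pullback_def by auto
  qed
next
  note [simp] = hom_Dom[OF f] hom_Dom[OF g] hom_Cod[OF f] hom_Cod[OF g] hom_Arr[OF f] hom_Arr[OF g]
  assume T: "tabulates X P p q A B ?R"
  note p = tabulates_fst[OF T] and q = tabulates_snd[OF T]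
  show "is_pullback (Cat_over X) f g P p q"
    unfolding is_pullback_def
  proof (intro conjI allI ballI impI)
    show "Comp (Cat_over X) f p = Comp (Cat_over X) g q"
      unfolding Comp_eq_iff[OF p q f g] using tabulates_mem[OF T] by auto
    fix Z a b
    assume "a \<in> hom_set (Cat_over X) Z (Dom (Cat_over X) f)"
      "b \<in> hom_set (Cat_over X) Z (Dom (Cat_over X) g)"
    then have a: "a \<in> hom_set (Cat_over X) Z A" and b: "b \<in> hom_set (Cat_over X) Z B"
      by simp_all
    assume "Comp (Cat_over X) f a = Comp (Cat_over X) g b"
    then show "\<exists>!h. h \<in> hom_set (Cat_over X) Z P \<and> Comp (Cat_over X) p h = a \<and>
        Comp (Cat_over X) q h = b"
      unfolding Comp_eq_iff[OF a b f g]
      by (intro tabulates_lift[OF T a b]) (auto simp: arr_map_Arr[OF a] arr_map_Arr[OF b])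
  qed (use p q in simp_all)
qed

text \<open>The case of joint monicity in which both legs are \<open>u\<close>.\<close>

lemma mono_arrow_inj:
  fixes X :: "'u::infinite set"
  assumes "mono_arrow (Cat_over X) u"
    and u: "u \<in> hom_set (Cat_over X) U C"
  shows "inj_on (arr_map u) (Arr U)"
proof (rule inj_onI)
  fix v w assume v: "v \<in> Arr U" "w \<in> Arr U" "arr_map u v = arr_map u w"
  show "v = w"
    by (rule jointly_monic_inj[OF u u _ v v(3)])
      (use assms(1) in \<open>auto simp: mono_arrow_def hom_Dom[OF u]\<close>)
qed

lemma equivD:
  assumes "equiv A r"
  shows equiv_refl: "a \<in> A \<Longrightarrow> (a, a) \<in> r"
    and equiv_sym: "(a, b) \<in> r \<Longrightarrow> (b, a) \<in> r"
    and equiv_trans: "(a, b) \<in> r \<Longrightarrow> (b, c) \<in> r \<Longrightarrow> (a, c) \<in> r"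
  using assms by (auto elim!: equivE dest: refl_onD symD transD)

section \<open>Internal equivalence relations and inverse images\<close>

text \<open>The relation is the image of the span, and the arrows witnessing internal reflexivity,
  symmetry and transitivity act on its elements. Compatibility with composition is obtained
  separately, in \<open>tabulates_compatible_rel\<close>.\<close>

lemma internal_equivalence_tabulates:
  fixes X :: "'u::infinite set"
  assumes "internal_equivalence (Cat_over X) C d\<^sub>0 d\<^sub>1"
  obtains R where "tabulates X (Dom (Cat_over X) d\<^sub>0) d\<^sub>0 d\<^sub>1 C C R" "equiv (Arr C) R"
proof -
  define D where "D = Dom (Cat_over X) d\<^sub>0"
  define R where "R = (\<lambda>r. (arr_map d\<^sub>0 r, arr_map d\<^sub>1 r)) ` Arr D"
  note eqv = assms[unfolded internal_equivalence_def internal_relation_def, folded D_def]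
  have d0: "d\<^sub>0 \<in> hom_set (Cat_over X) D C" and d1: "d\<^sub>1 \<in> hom_set (Cat_over X) D C"
    using eqv by simp_all
  have T: "tabulates X D d\<^sub>0 d\<^sub>1 C C R"
  proof (rule tabulatesI[OF d0 d1])
    fix v w assume v: "v \<in> Arr D" "w \<in> Arr D" "arr_map d\<^sub>0 v = arr_map d\<^sub>0 w"
      "arr_map d\<^sub>1 v = arr_map d\<^sub>1 w"
    show "v = w"
      by (rule jointly_monic_inj[OF d0 d1 _ v])
        (use conjunct1[OF eqv] in blast)
  qed (auto simp: R_def)
  have C: "C \<in> Obj (Cat_over X)" using hom_Obj_Cat_over(2)[OF d0] .
  obtain s where s: "s \<in> hom_set (Cat_over X) C D" "Comp (Cat_over X) d\<^sub>0 s = Ident (Cat_over X) C"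
    "Comp (Cat_over X) d\<^sub>1 s = Ident (Cat_over X) C"
    using conjunct1[OF conjunct2[OF eqv]] by blast
  obtain t where t: "t \<in> hom_set (Cat_over X) D D" "Comp (Cat_over X) d\<^sub>0 t = d\<^sub>1"
    "Comp (Cat_over X) d\<^sub>1 t = d\<^sub>0"
    using conjunct1[OF conjunct2[OF conjunct2[OF eqv]]] by blast
  have R1: "R \<subseteq> Arr C \<times> Arr C"
    by (auto simp: R_def arr_map_Arr[OF d0] arr_map_Arr[OF d1])
  have R2: "(a, a) \<in> R" if a: "a \<in> Arr C" for a
    using tabulates_mem[OF T arr_map_Arr[OF s(1) a]]
    by (simp add: arr_map_Comp_Cat_over[OF s(1) d0 a, symmetric]
        arr_map_Comp_Cat_over[OF s(1) d1 a, symmetric] arr_map_Ident_Cat_over[OF C a] s(2,3))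
  have R3: "(b, a) \<in> R" if ab: "(a, b) \<in> R" for a b
  proof -
    obtain r where r: "r \<in> Arr D" "arr_map d\<^sub>0 r = a" "arr_map d\<^sub>1 r = b"
      using tabulates_ex[OF T ab] by blast
    show ?thesis
      using tabulates_mem[OF T arr_map_Arr[OF t(1) r(1)]]
      by (simp add: arr_map_Comp_Cat_over[OF t(1) d0 r(1), symmetric]
          arr_map_Comp_Cat_over[OF t(1) d1 r(1), symmetric] t(2,3) r)
  qed
  have R4: "(a, c) \<in> R" if ab: "(a, b) \<in> R" and bc: "(b, c) \<in> R" for a b c
  proof -
    \<comment> \<open>Internal transitivity speaks about any pullback of \<open>d\<^sub>1\<close>
      and \<open>d\<^sub>0\<close>, so one has to be produced: a tabulation of the pairs that agree
      in the middle.\<close>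
    let ?F = "{(r, r'). r \<in> Arr D \<and> r' \<in> Arr D \<and> arr_map d\<^sub>1 r = arr_map d\<^sub>0 r'}"
    have "?F = {(r, r') \<in> parallel D D. arr_map d\<^sub>1 r = arr_map d\<^sub>0 r'}"
      using parallel_of_arr_map_eq[OF d1 d0] by (auto simp: parallel_iff)
    then have "compatible_rel D D ?F"
      using compatible_rel_equalizer[OF d1 d0 compatible_rel_parallel] hom_category_dom[OF d0]
      by simp
    with hom_Obj_Cat_over(1)[OF d0] hom_Obj_Cat_over(1)[OF d0]
    obtain P p q where F: "tabulates X P p q D D ?F"
      by (rule ex_tabulates)
    note p = tabulates_fst[OF F] and q = tabulates_snd[OF F]
    obtain m where m: "m \<in> hom_set (Cat_over X) P D"
      "Comp (Cat_over X) d\<^sub>0 m = Comp (Cat_over X) d\<^sub>0 p"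
      "Comp (Cat_over X) d\<^sub>1 m = Comp (Cat_over X) d\<^sub>1 q"
      using conjunct2[OF conjunct2[OF conjunct2[OF eqv]]]
        iffD2[OF is_pullback_iff_tabulates[OF d1 d0] F] by blast
    obtain r r' where r: "r \<in> Arr D" "r' \<in> Arr D" "arr_map d\<^sub>0 r = a" "arr_map d\<^sub>1 r = b"
      "arr_map d\<^sub>0 r' = b" "arr_map d\<^sub>1 r' = c"
      using tabulates_ex[OF T ab] tabulates_ex[OF T bc] by blast
    then have "(r, r') \<in> ?F" by simp
    then obtain v where v: "v \<in> Arr P" "arr_map p v = r" "arr_map q v = r'"
      using tabulates_ex[OF F] by blast
    have "arr_map d\<^sub>0 (arr_map m v) = a" "arr_map d\<^sub>1 (arr_map m v) = c"
      using arr_map_Comp_Cat_over[OF m(1) d0 v(1)] arr_map_Comp_Cat_over[OF m(1) d1 v(1)]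
        arr_map_Comp_Cat_over[OF p d0 v(1)] arr_map_Comp_Cat_over[OF q d1 v(1)] m v r by simp_all
    then show ?thesis
      using tabulates_mem[OF T arr_map_Arr[OF m(1) v(1)]] by simp
  qed
  have "equiv (Arr C) R"
    by (rule equivI[OF R1 refl_onI symI transI]) (rule R2 R3 R4, assumption+)+
  with T show ?thesis unfolding D_def by (rule that)
qed

text \<open>Each law of an equivalence relation says that a certain pair of functors takes its
  values in \<open>R\<close>; \<open>tabulates_lift\<close> then supplies the internal structure
  arrow.\<close>

lemma tabulates_internal_equivalence:
  fixes X :: "'u::infinite set"
  assumes T: "tabulates X D d\<^sub>0 d\<^sub>1 C C R" and R: "equiv (Arr C) R"
  shows "internal_equivalence (Cat_over X) C d\<^sub>0 d\<^sub>1"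
proof -
  note d0 = tabulates_fst[OF T] and d1 = tabulates_snd[OF T]
  have C: "C \<in> Obj (Cat_over X)" using hom_Obj_Cat_over(2)[OF d0] .
  note I = Ident_Cat_over[OF C]
  show ?thesis
    unfolding internal_equivalence_def internal_relation_def hom_Dom[OF d0]
  proof (intro conjI allI ballI impI d0 d1)
    fix Z f g
    assume f: "f \<in> hom_set (Cat_over X) Z D" and g: "g \<in> hom_set (Cat_over X) Z D"
      and e: "Comp (Cat_over X) d\<^sub>0 f = Comp (Cat_over X) d\<^sub>0 g \<and>
        Comp (Cat_over X) d\<^sub>1 f = Comp (Cat_over X) d\<^sub>1 g"
    show "f = g"
    proof (rule hom_Cat_over_eqI[OF f g])
      fix z assume z: "z \<in> Arr Z"
      show "arr_map f z = arr_map g z"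
        by (rule tabulates_inj[OF T arr_map_Arr[OF f z] arr_map_Arr[OF g z]])
          (use e z in \<open>simp_all add: Comp_eq_iff[OF f g d0 d0] Comp_eq_iff[OF f g d1 d1]\<close>)
    qed
  next
    show "\<exists>s\<in>hom_set (Cat_over X) C D. Comp (Cat_over X) d\<^sub>0 s = Ident (Cat_over X) C \<and>
        Comp (Cat_over X) d\<^sub>1 s = Ident (Cat_over X) C"
      using tabulates_lift[OF T I(1) I(1)] I(2) equiv_refl[OF R] by auto
  next
    have "(arr_map d\<^sub>1 z, arr_map d\<^sub>0 z) \<in> R" if "z \<in> Arr D" for z
      using equiv_sym[OF R tabulates_mem[OF T that]] .
    then show "\<exists>t\<in>hom_set (Cat_over X) D D. Comp (Cat_over X) d\<^sub>0 t = d\<^sub>1 \<and> Comp (Cat_over X) d\<^sub>1 t = d\<^sub>0"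
      using tabulates_lift[OF T d1 d0] by auto
  next
    fix P p q assume "is_pullback (Cat_over X) d\<^sub>1 d\<^sub>0 P p q"
    note F = this[unfolded is_pullback_iff_tabulates[OF d1 d0]]
    note p = tabulates_fst[OF F] and q = tabulates_snd[OF F]
    have "(arr_map (Comp (Cat_over X) d\<^sub>0 p) z, arr_map (Comp (Cat_over X) d\<^sub>1 q) z) \<in> R"
      if z: "z \<in> Arr P" for z
      unfolding arr_map_Comp_Cat_over[OF p d0 z] arr_map_Comp_Cat_over[OF q d1 z]
      using tabulates_mem[OF T arr_map_Arr[OF p z]] tabulates_mem[OF T arr_map_Arr[OF q z]]
        tabulates_mem[OF F z] by (auto intro: equiv_trans[OF R])
    then show "\<exists>m\<in>hom_set (Cat_over X) P D. Comp (Cat_over X) d\<^sub>0 m = Comp (Cat_over X) d\<^sub>0 p \<and>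
        Comp (Cat_over X) d\<^sub>1 m = Comp (Cat_over X) d\<^sub>1 q"
      using tabulates_lift[OF T Comp_Cat_over_hom[OF p d0] Comp_Cat_over_hom[OF q d1]] by auto
  qed
qed

text \<open>The image of a functor need not be closed under composition in general. Here it is,
  because the functors fix objects, so that composability of images can be read off in
  \<open>D\<close>.\<close>

lemma tabulates_compatible_rel:
  assumes T: "tabulates X D d\<^sub>0 d\<^sub>1 A B R"
  shows "compatible_rel A B R"
proof (rule compatible_relI)
  note d0 = tabulates_fst[OF T] and d1 = tabulates_snd[OF T]
  fix f g assume "(f, g) \<in> R"
  then obtain r where r: "r \<in> Arr D" "arr_map d\<^sub>0 r = f" "arr_map d\<^sub>1 r = g"
    using tabulates_ex[OF T] by blast
  then show "f \<in> Arr A \<and> g \<in> Arr B \<and> Dom A f = Dom B g \<and> Cod A f = Cod B g"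
    using arr_map_Arr[OF d0 r(1)] arr_map_Arr[OF d1 r(1)] Dom_arr_map[OF d0 r(1)]
      Dom_arr_map[OF d1 r(1)] Cod_arr_map[OF d0 r(1)] Cod_arr_map[OF d1 r(1)] by simp
  fix f' g' assume "(f', g') \<in> R" and c: "Cod A f = Dom A f'"
  then obtain r' where r': "r' \<in> Arr D" "arr_map d\<^sub>0 r' = f'" "arr_map d\<^sub>1 r' = g'"
    using tabulates_ex[OF T] by blast
  have c': "Cod D r = Dom D r'"
    using c r r' Dom_arr_map[OF d0 r'(1)] Cod_arr_map[OF d0 r(1)] by simp
  show "(Comp A f' f, Comp B g' g) \<in> R"
    using tabulates_mem[OF T category_Comp[OF hom_category_dom[OF d0] r(1) r'(1) c']] r r' c'
    by (simp add: arr_map_Comp[OF d0] arr_map_Comp[OF d1])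
next
  note d0 = tabulates_fst[OF T] and d1 = tabulates_snd[OF T]
  fix x assume "x \<in> Obj A"
  then have x: "x \<in> X" using hom_Obj_cod[OF d0] by simp
  then have "Ident D x \<in> Arr D"
    using category_Ident[OF hom_category_dom[OF d0]] hom_Obj_dom[OF d0] by simp
  from tabulates_mem[OF T this] show "(Ident A x, Ident B x) \<in> R"
    by (simp add: arr_map_Ident[OF d0 x] arr_map_Ident[OF d1 x])
qed

text \<open>An inverse image amounts to the restriction of the relation to \<open>U\<close>. The
  conclusion keeps what candidates draw on: \<open>t\<close> relates the second projections, for
  saturation, and \<open>V\<close> realizes every pair of arrows of \<open>U\<close> with related
  images, for the inclusion in \<open>S\<close>.\<close>

lemma is_inverse_imageD:
  fixes X :: "'u::infinite set"
  assumes d0: "d\<^sub>0 \<in> hom_set (Cat_over X) D C" and d1: "d\<^sub>1 \<in> hom_set (Cat_over X) D C"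
    and u: "u \<in> hom_set (Cat_over X) U C"
    and inv: "is_inverse_image (Cat_over X) u d\<^sub>0 d\<^sub>1 v\<^sub>0 v\<^sub>1 t"
  obtains V where "v\<^sub>0 \<in> hom_set (Cat_over X) V U" "v\<^sub>1 \<in> hom_set (Cat_over X) V U"
    "t \<in> hom_set (Cat_over X) V D"
    "\<And>v. v \<in> Arr V \<Longrightarrow> arr_map d\<^sub>1 (arr_map t v) = arr_map u (arr_map v\<^sub>1 v)"
    "\<And>r a b. r \<in> Arr D \<Longrightarrow> a \<in> Arr U \<Longrightarrow> b \<in> Arr U \<Longrightarrow> arr_map d\<^sub>0 r = arr_map u a \<Longrightarrow>
      arr_map d\<^sub>1 r = arr_map u b \<Longrightarrow> \<exists>v\<in>Arr V. arr_map v\<^sub>0 v = a \<and> arr_map v\<^sub>1 v = b"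
proof -
  define V where "V = Dom (Cat_over X) v\<^sub>0"
  obtain P p\<^sub>0 p\<^sub>1 Q q\<^sub>0 q\<^sub>1 m w n where
    PT: "tabulates X P p\<^sub>0 p\<^sub>1 C C (parallel C C)" and QT: "tabulates X Q q\<^sub>0 q\<^sub>1 U U (parallel U U)"
    and m: "m \<in> hom_set (Cat_over X) D P" and w: "w \<in> hom_set (Cat_over X) Q P"
    and n: "n \<in> hom_set (Cat_over X) V Q"
    and e: "Comp (Cat_over X) p\<^sub>0 m = d\<^sub>0" "Comp (Cat_over X) p\<^sub>1 m = d\<^sub>1"
      "Comp (Cat_over X) p\<^sub>0 w = Comp (Cat_over X) u q\<^sub>0"
      "Comp (Cat_over X) p\<^sub>1 w = Comp (Cat_over X) u q\<^sub>1"
      "Comp (Cat_over X) q\<^sub>0 n = v\<^sub>0" "Comp (Cat_over X) q\<^sub>1 n = v\<^sub>1"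
    and pb: "is_pullback (Cat_over X) m w V t n"
    using inv unfolding is_inverse_image_def hom_Dom[OF u] hom_Cod[OF u] hom_Dom[OF d0]
      is_product_iff_tabulates V_def by blast
  note F = pb[unfolded is_pullback_iff_tabulates[OF m w]]
  note p0 = tabulates_fst[OF PT] and p1 = tabulates_snd[OF PT]
  note q0 = tabulates_fst[OF QT] and q1 = tabulates_snd[OF QT]
  note t = tabulates_fst[OF F]
  have v0: "v\<^sub>0 \<in> hom_set (Cat_over X) V U" and v1: "v\<^sub>1 \<in> hom_set (Cat_over X) V U"
    using Comp_Cat_over_hom[OF n q0] Comp_Cat_over_hom[OF n q1] e by simp_all
  note pm = e(1)[unfolded Comp_eq_iff'[OF m p0 d0], rule_format]
    e(2)[unfolded Comp_eq_iff'[OF m p1 d1], rule_format]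
  note pw = e(3)[unfolded Comp_eq_iff[OF w q0 p0 u], rule_format]
    e(4)[unfolded Comp_eq_iff[OF w q1 p1 u], rule_format]
  note qn = e(5)[unfolded Comp_eq_iff'[OF n q0 v0], rule_format]
    e(6)[unfolded Comp_eq_iff'[OF n q1 v1], rule_format]
  show thesis
  proof (rule that[OF v0 v1 t])
    fix v assume v: "v \<in> Arr V"
    then have "arr_map m (arr_map t v) = arr_map w (arr_map n v)"
      using tabulates_mem[OF F] by simp
    then show "arr_map d\<^sub>1 (arr_map t v) = arr_map u (arr_map v\<^sub>1 v)"
      using pm(2)[OF arr_map_Arr[OF t v]] pw(2)[OF arr_map_Arr[OF n v]] qn(2)[OF v] by metis
  next
    fix r a b
    assume r: "r \<in> Arr D" and ab: "a \<in> Arr U" "b \<in> Arr U"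
      and eq: "arr_map d\<^sub>0 r = arr_map u a" "arr_map d\<^sub>1 r = arr_map u b"
    have "(a, b) \<in> parallel U U"
      using ab eq Dom_arr_map[OF d0 r] Dom_arr_map[OF d1 r] Cod_arr_map[OF d0 r]
        Cod_arr_map[OF d1 r] Dom_arr_map[OF u ab(1)] Dom_arr_map[OF u ab(2)]
        Cod_arr_map[OF u ab(1)] Cod_arr_map[OF u ab(2)] by (simp add: parallel_iff)
    then obtain z where z: "z \<in> Arr Q" "arr_map q\<^sub>0 z = a" "arr_map q\<^sub>1 z = b"
      using tabulates_ex[OF QT] by blast
    \<comment> \<open>Both sides have the components \<open>arr_map u a\<close> and
      \<open>arr_map u b\<close> in \<open>P\<close>, so \<open>r\<close> and \<open>z\<close> match
      in the pullback.\<close>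
    have "arr_map m r = arr_map w z"
      by (rule tabulates_inj[OF PT arr_map_Arr[OF m r] arr_map_Arr[OF w z(1)]])
        (use pm[OF r] pw[OF z(1)] eq z in simp_all)
    then have "\<exists>v\<in>Arr V. arr_map t v = r \<and> arr_map n v = z"
      using tabulates_ex[OF F, of r z] r z(1) by simp
    then show "\<exists>v\<in>Arr V. arr_map v\<^sub>0 v = a \<and> arr_map v\<^sub>1 v = b"
      using qn z by metis
  qed
qed

text \<open>The comparison arrows into the two products are lifts; \<open>(t, n)\<close> is then a
  pullback because equality in a product is checked on both components.\<close>

lemma is_inverse_imageI:
  fixes X :: "'u::infinite set"
  assumes T: "tabulates X D d\<^sub>0 d\<^sub>1 C C R" and u: "u \<in> hom_set (Cat_over X) U C"
    and V: "tabulates X V v\<^sub>0 v\<^sub>1 U U {(a, b). a \<in> Arr U \<and> b \<in> Arr U \<and> (arr_map u a, arr_map u b) \<in> R}"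
    and t: "t \<in> hom_set (Cat_over X) V D"
    and t0: "\<And>v. v \<in> Arr V \<Longrightarrow> arr_map d\<^sub>0 (arr_map t v) = arr_map u (arr_map v\<^sub>0 v)"
    and t1: "\<And>v. v \<in> Arr V \<Longrightarrow> arr_map d\<^sub>1 (arr_map t v) = arr_map u (arr_map v\<^sub>1 v)"
  shows "is_inverse_image (Cat_over X) u d\<^sub>0 d\<^sub>1 v\<^sub>0 v\<^sub>1 t"
proof -
  note d0 = tabulates_fst[OF T] and d1 = tabulates_snd[OF T]
  note v0 = tabulates_fst[OF V] and v1 = tabulates_snd[OF V]
  obtain P p\<^sub>0 p\<^sub>1 where PT: "tabulates X P p\<^sub>0 p\<^sub>1 C C (parallel C C)"
    using ex_tabulates[OF _ _ compatible_rel_parallel] hom_Obj_Cat_over(2)[OF u]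
      hom_category_cod[OF u] by metis
  obtain Q q\<^sub>0 q\<^sub>1 where QT: "tabulates X Q q\<^sub>0 q\<^sub>1 U U (parallel U U)"
    using ex_tabulates[OF _ _ compatible_rel_parallel] hom_Obj_Cat_over(1)[OF u]
      hom_category_dom[OF u] by metis
  note p0 = tabulates_fst[OF PT] and p1 = tabulates_snd[OF PT]
  note q0 = tabulates_fst[OF QT] and q1 = tabulates_snd[OF QT]
  obtain m where m: "m \<in> hom_set (Cat_over X) D P"
    and pm: "Comp (Cat_over X) p\<^sub>0 m = d\<^sub>0" "Comp (Cat_over X) p\<^sub>1 m = d\<^sub>1"
    using tabulates_lift[OF PT d0 d1 arr_map_parallel[OF d0 d1]] by blast
  note uq = Comp_Cat_over_hom[OF q0 u] Comp_Cat_over_hom[OF q1 u]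
  obtain w where w: "w \<in> hom_set (Cat_over X) Q P"
    and pw: "Comp (Cat_over X) p\<^sub>0 w = Comp (Cat_over X) u q\<^sub>0"
      "Comp (Cat_over X) p\<^sub>1 w = Comp (Cat_over X) u q\<^sub>1"
    using tabulates_lift[OF PT uq arr_map_parallel[OF uq]] by blast
  obtain n where n: "n \<in> hom_set (Cat_over X) V Q"
    and qn: "Comp (Cat_over X) q\<^sub>0 n = v\<^sub>0" "Comp (Cat_over X) q\<^sub>1 n = v\<^sub>1"
    using tabulates_lift[OF QT v0 v1 arr_map_parallel[OF v0 v1]] by blast
  note pm' = pm(1)[unfolded Comp_eq_iff'[OF m p0 d0], rule_format]
    pm(2)[unfolded Comp_eq_iff'[OF m p1 d1], rule_format]
  note pw' = pw(1)[unfolded Comp_eq_iff[OF w q0 p0 u], rule_format]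
    pw(2)[unfolded Comp_eq_iff[OF w q1 p1 u], rule_format]
  note qn' = qn(1)[unfolded Comp_eq_iff'[OF n q0 v0], rule_format]
    qn(2)[unfolded Comp_eq_iff'[OF n q1 v1], rule_format]
  have "tabulates X V t n D Q {(a, b). a \<in> Arr D \<and> b \<in> Arr Q \<and> arr_map m a = arr_map w b}"
  proof (rule tabulatesI[OF t n])
    fix v assume v: "v \<in> Arr V"
    have "arr_map m (arr_map t v) = arr_map w (arr_map n v)"
      by (rule tabulates_inj[OF PT])
        (simp_all add: v arr_map_Arr[OF m] arr_map_Arr[OF w] arr_map_Arr[OF t] arr_map_Arr[OF n]
          pm' pw' qn' t0 t1)
    then show "(arr_map t v, arr_map n v) \<in>
        {(a, b). a \<in> Arr D \<and> b \<in> Arr Q \<and> arr_map m a = arr_map w b}"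
      by (simp add: v arr_map_Arr[OF t] arr_map_Arr[OF n])
  next
    fix a b assume "(a, b) \<in> {(a, b). a \<in> Arr D \<and> b \<in> Arr Q \<and> arr_map m a = arr_map w b}"
    then have a: "a \<in> Arr D" and b: "b \<in> Arr Q" and e: "arr_map m a = arr_map w b" by auto
    have e': "arr_map d\<^sub>0 a = arr_map u (arr_map q\<^sub>0 b)" "arr_map d\<^sub>1 a = arr_map u (arr_map q\<^sub>1 b)"
      using pm'[OF a] pw'[OF b] e by simp_all
    then have "(arr_map u (arr_map q\<^sub>0 b), arr_map u (arr_map q\<^sub>1 b)) \<in> R"
      using tabulates_mem[OF T a] by simp
    then obtain v where v: "v \<in> Arr V" "arr_map v\<^sub>0 v = arr_map q\<^sub>0 b" "arr_map v\<^sub>1 v = arr_map q\<^sub>1 b"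
      using tabulates_ex[OF V, of "arr_map q\<^sub>0 b" "arr_map q\<^sub>1 b"]
      by (auto simp: b arr_map_Arr[OF q0] arr_map_Arr[OF q1])
    have "arr_map t v = a"
      by (rule tabulates_inj[OF T]) (simp_all add: v a arr_map_Arr[OF t] t0 t1 e')
    moreover have "arr_map n v = b"
      by (rule tabulates_inj[OF QT]) (simp_all add: v b arr_map_Arr[OF n] qn')
    ultimately show "\<exists>v\<in>Arr V. arr_map t v = a \<and> arr_map n v = b" using v by blast
  next
    \<comment> \<open>\<open>n\<close> alone separates arrows, as its components
      \<open>v\<^sub>0\<close> and \<open>v\<^sub>1\<close> do so jointly.\<close>
    fix v v' assume v: "v \<in> Arr V" "v' \<in> Arr V" "arr_map n v = arr_map n v'"
    show "v = v'"
      by (rule tabulates_inj[OF V v(1,2)])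
        (use v qn'[OF v(1)] qn'[OF v(2)] in simp_all)
  qed
  then have "is_pullback (Cat_over X) m w V t n"
    by (simp only: is_pullback_iff_tabulates[OF m w])
  then show ?thesis
    unfolding is_inverse_image_def is_product_iff_tabulates hom_Dom[OF u] hom_Cod[OF u]
      hom_Dom[OF d0] hom_Dom[OF v0]
    using PT QT m w n pm pw qn by blast
qed

section \<open>The syntactic congruence\<close>

definition syntactic_rel :: "('o, 'a) cat \<Rightarrow> ('a \<times> 'a) set \<Rightarrow> ('a \<times> 'a) set" where
  "syntactic_rel C E = {(f, g) \<in> parallel C C.
     \<forall>h\<in>Arr C. \<forall>k\<in>Arr C. Cod C k = Dom C f \<longrightarrow> Dom C h = Cod C f \<longrightarrow>
       (Comp C h (Comp C f k), Comp C h (Comp C g k)) \<in> E}"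

lemma equiv_syntactic_rel:
  assumes C: "category C" and E: "equiv (Arr C) E"
  shows "equiv (Arr C) (syntactic_rel C E)"
proof (rule equivI[OF _ refl_onI symI transI])
  fix f g assume "(f, g) \<in> syntactic_rel C E"
  then show "(g, f) \<in> syntactic_rel C E"
    using equiv_sym[OF E] by (auto simp: syntactic_rel_def parallel_iff)
next
  fix f g h assume "(f, g) \<in> syntactic_rel C E" "(g, h) \<in> syntactic_rel C E"
  then show "(f, h) \<in> syntactic_rel C E"
    using equiv_trans[OF E] by (simp add: syntactic_rel_def parallel_iff) metis
qed (auto simp: syntactic_rel_def parallel_iff category_simps[OF C] intro: equiv_refl[OF E])

text \<open>The context formed by two identities leaves both arrows unchanged.\<close>

lemma syntactic_rel_subset:
  assumes C: "category C"
  shows "syntactic_rel C E \<subseteq> E"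
proof
  fix a assume "a \<in> syntactic_rel C E"
  then obtain f g where a: "a = (f, g)" and p: "(f, g) \<in> parallel C C"
    and c: "\<forall>h\<in>Arr C. \<forall>k\<in>Arr C. Cod C k = Dom C f \<longrightarrow> Dom C h = Cod C f \<longrightarrow>
       (Comp C h (Comp C f k), Comp C h (Comp C g k)) \<in> E"
    unfolding syntactic_rel_def by auto
  show "a \<in> E"
    using p c[rule_format, of "Ident C (Cod C f)" "Ident C (Dom C f)"]
    by (simp add: a parallel_iff category_simps[OF C])
qed

text \<open>A composite is replaced factor by factor: \<open>f\<close> becomes \<open>g\<close> in
  the context of \<open>h f'\<close> and \<open>k\<close>, then \<open>f'\<close> becomes
  \<open>g'\<close> in the context of \<open>h\<close> and \<open>g k\<close>. Transitivity of
  \<open>E\<close> joins the two steps.\<close>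

lemma compatible_syntactic_rel:
  assumes C: "category C" and E: "equiv (Arr C) E"
  shows "compatible_rel C C (syntactic_rel C E)"
proof (rule compatible_relI)
  fix x assume "x \<in> Obj C"
  then show "(Ident C x, Ident C x) \<in> syntactic_rel C E"
    using equiv_syntactic_rel[OF C E] by (auto simp: equiv_def refl_on_def category_simps[OF C])
next
  fix f g f' g'
  assume fg: "(f, g) \<in> syntactic_rel C E" "(f', g') \<in> syntactic_rel C E" and c: "Cod C f = Dom C f'"
  then have p: "f \<in> Arr C" "g \<in> Arr C" "f' \<in> Arr C" "g' \<in> Arr C" "Dom C g = Dom C f"
    "Cod C g = Dom C f'" "Dom C g' = Dom C f'" "Cod C g' = Cod C f'"
    by (auto simp: syntactic_rel_def parallel_iff)
  note [simp] = category_simps[OF C] p c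
  have "(Comp C h (Comp C (Comp C f' f) k), Comp C h (Comp C (Comp C g' g) k)) \<in> E"
    if h: "h \<in> Arr C" "Dom C h = Cod C f'" and k: "k \<in> Arr C" "Cod C k = Dom C f" for h k
  proof -
    note [simp] = h k
    have "(Comp C (Comp C h f') (Comp C f k), Comp C (Comp C h f') (Comp C g k)) \<in> E"
      using fg(1) by (simp add: syntactic_rel_def del: category_Comp_assoc[OF C])
    moreover have "(Comp C h (Comp C f' (Comp C g k)), Comp C h (Comp C g' (Comp C g k))) \<in> E"
      using fg(2) by (simp add: syntactic_rel_def)
    ultimately show ?thesis
      using equiv_trans[OF E] by simp
  qed
  then show "(Comp C f' f, Comp C g' g) \<in> syntactic_rel C E"
    by (simp add: syntactic_rel_def parallel_iff)
qed (auto simp: syntactic_rel_def parallel_iff)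

text \<open>Reflexivity makes \<open>(h, h)\<close> and \<open>(k, k)\<close> available for
  composition, so \<open>R\<close> is closed under contexts; the inclusion in \<open>E\<close> is
  applied afterwards.\<close>

lemma syntactic_rel_greatest:
  assumes C: "category C" and R: "compatible_rel C C R" "refl_on (Arr C) R" "R \<subseteq> E"
  shows "R \<subseteq> syntactic_rel C E"
proof
  fix a assume "a \<in> R"
  moreover obtain f g where a: "a = (f, g)" by (cases a)
  ultimately have fg: "(f, g) \<in> R" by simp
  note p = compatible_relD(1)[OF R(1) fg]
  have "(Comp C h (Comp C f k), Comp C h (Comp C g k)) \<in> R"
    if h: "h \<in> Arr C" "Dom C h = Cod C f" and k: "k \<in> Arr C" "Cod C k = Dom C f" for h k
  proof -
    have hk: "(h, h) \<in> R" "(k, k) \<in> R"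
      using R(2) h k by (auto simp: refl_on_def)
    have "(Comp C f k, Comp C g k) \<in> R"
      by (rule compatible_relD(3)[OF R(1) hk(2) fg k(2)])
    then show ?thesis
      by (rule compatible_relD(3)[OF R(1) _ hk(1)]) (use p h k in \<open>simp add: category_simps[OF C]\<close>)
  qed
  then show "a \<in> syntactic_rel C E"
    using p R(3) by (auto simp: a syntactic_rel_def parallel_iff)
qed

section \<open>Extending an equivalence relation along an injection\<close>

lemma map_prod_image_mem_iff:
  assumes "inj_on f A" "S \<subseteq> A \<times> A" "x \<in> A" "y \<in> A"
  shows "(f x, f y) \<in> map_prod f f ` S \<longleftrightarrow> (x, y) \<in> S"
  using inj_on_image_mem_iff[OF map_prod_inj_on[OF assms(1) assms(1)], of "(x, y)" S] assms
  by simp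

text \<open>Membership of either entry in the image of \<open>f\<close> forces membership of both,
  so the relation splits into a copy of \<open>S\<close> on the image and the full relation on its
  complement.\<close>

lemma equiv_extend_image:
  assumes S: "equiv A S" and f: "inj_on f A" "f ` A \<subseteq> B"
  shows "equiv B {(a, b) \<in> B \<times> B. a \<in> f ` A \<or> b \<in> f ` A \<longrightarrow> (a, b) \<in> map_prod f f ` S}"
    (is "equiv B ?E")
proof -
  have SA: "x \<in> A \<and> y \<in> A" if "(x, y) \<in> S" for x y
    using that equiv_type[OF S] by blast
  have imI: "(f x, f y) \<in> map_prod f f ` S" if "(x, y) \<in> S" for x y
    using that by (rule map_prod_imageI)
  have imE: "\<exists>x y. (x, y) \<in> S \<and> a = f x \<and> b = f y" if "(a, b) \<in> map_prod f f ` S" for a b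
    using that by auto
  have im: "a \<in> f ` A \<and> b \<in> f ` A" if "(a, b) \<in> map_prod f f ` S" for a b
    using imE[OF that] SA by blast
  note mem = iffD1[OF map_prod_image_mem_iff[OF f(1) equiv_type[OF S]]]
  show ?thesis
  proof (rule equivI[OF _ refl_onI symI transI])
    fix a assume "a \<in> B"
    then show "(a, a) \<in> ?E" using imI equiv_refl[OF S] by blast
  next
    fix a b assume ab: "(a, b) \<in> ?E"
    have "(b, a) \<in> map_prod f f ` S" if "(a, b) \<in> map_prod f f ` S"
      using imE[OF that] imI equiv_sym[OF S] by blast
    then show "(b, a) \<in> ?E"
      using ab by (simp only: mem_Collect_eq case_prod_conv mem_Times_iff fst_conv snd_conv) blast
  next
    fix a b c assume ab: "(a, b) \<in> ?E" and bc: "(b, c) \<in> ?E"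
    have abS: "(a, b) \<in> map_prod f f ` S" if "a \<in> f ` A \<or> b \<in> f ` A"
      using ab that by (simp only: mem_Collect_eq case_prod_conv)
    have bcS: "(b, c) \<in> map_prod f f ` S" if "b \<in> f ` A \<or> c \<in> f ` A"
      using bc that by (simp only: mem_Collect_eq case_prod_conv)
    have "(a, c) \<in> map_prod f f ` S" if ac: "a \<in> f ` A \<or> c \<in> f ` A"
    proof -
      \<comment> \<open>One end in the image puts the middle entry there too; injectivity of
        \<open>f\<close> then makes the two preimages of \<open>b\<close> agree.\<close>
      have b: "b \<in> f ` A" using ac im abS bcS by blast
      then obtain x y z where "x \<in> A" "y \<in> A" "z \<in> A" and e: "a = f x" "b = f y" "c = f z"
        using im abS bcS by blast
      then have "(x, y) \<in> S" "(y, z) \<in> S"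
        using mem abS bcS b by simp_all
      then show ?thesis unfolding e by (intro imI) (rule equiv_trans[OF S])
    qed
    then show "(a, c) \<in> ?E"
      using ab bc by (simp only: mem_Collect_eq case_prod_conv mem_Times_iff fst_conv snd_conv) blast
  qed blast
qed

section \<open>Saturating candidates\<close>

text \<open>Saturation carries membership in the image from the first entry of a related pair to the
  second, symmetry of \<open>R\<close> gives the other direction, and the inclusion of the inverse
  image in \<open>S\<close> relates the preimages.\<close>

lemma saturating_candidate_tabulates:
  fixes X :: "'u::infinite set"
  assumes u: "u \<in> hom_set (Cat_over X) U C"
    and S: "tabulates X D\<^sub>S s\<^sub>0 s\<^sub>1 U U S"
    and cand: "saturating_candidate (Cat_over X) u s\<^sub>0 s\<^sub>1 d\<^sub>0 d\<^sub>1"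
  obtains D R where "tabulates X D d\<^sub>0 d\<^sub>1 C C R" "equiv (Arr C) R"
    "\<And>a b. (a, b) \<in> R \<Longrightarrow> a \<in> arr_map u ` Arr U \<or> b \<in> arr_map u ` Arr U \<Longrightarrow>
      (a, b) \<in> map_prod (arr_map u) (arr_map u) ` S"
proof -
  have eqv: "internal_equivalence (Cat_over X) C d\<^sub>0 d\<^sub>1"
    and satd: "saturated (Cat_over X) u d\<^sub>0 d\<^sub>1"
    and le: "inverse_image_le (Cat_over X) u d\<^sub>0 d\<^sub>1 s\<^sub>0 s\<^sub>1"
    using cand unfolding saturating_candidate_def hom_Cod[OF u] by simp_all
  obtain D R where T: "tabulates X D d\<^sub>0 d\<^sub>1 C C R" and R: "equiv (Arr C) R"
    using internal_equivalence_tabulates[OF eqv] by blast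
  note d0 = tabulates_fst[OF T] and d1 = tabulates_snd[OF T]
  note s0 = tabulates_fst[OF S] and s1 = tabulates_snd[OF S]
  have sat: "b \<in> arr_map u ` Arr U" if ab: "(a, b) \<in> R" "a \<in> arr_map u ` Arr U" for a b
  proof -
    obtain v\<^sub>0 v\<^sub>1 t where inv: "is_inverse_image (Cat_over X) u d\<^sub>0 d\<^sub>1 v\<^sub>0 v\<^sub>1 t"
      and pb: "is_pullback (Cat_over X) d\<^sub>0 u (Dom (Cat_over X) v\<^sub>0) t v\<^sub>0"
      using satd unfolding saturated_def by blast
    obtain V where v0: "v\<^sub>0 \<in> hom_set (Cat_over X) V U" and v1: "v\<^sub>1 \<in> hom_set (Cat_over X) V U"
      and t1: "\<And>v. v \<in> Arr V \<Longrightarrow> arr_map d\<^sub>1 (arr_map t v) = arr_map u (arr_map v\<^sub>1 v)"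
      by (rule is_inverse_imageD[OF d0 d1 u inv]) blast
    note F = pb[unfolded hom_Dom[OF v0] is_pullback_iff_tabulates[OF d0 u]]
    obtain r z where "r \<in> Arr D" "arr_map d\<^sub>0 r = a" "arr_map d\<^sub>1 r = b" "z \<in> Arr U" "a = arr_map u z"
      using tabulates_ex[OF T ab(1)] ab(2) by blast
    \<comment> \<open>\<open>r\<close> and \<open>z\<close> agree over \<open>C\<close>, so the
      saturation square yields \<open>v\<close> over \<open>r\<close>; then \<open>t1\<close> puts
      the second entry of the pair in the image of \<open>u\<close>.\<close>
    moreover from this obtain v where "v \<in> Arr V" "arr_map t v = r"
      using tabulates_ex[OF F, of r z] by auto
    ultimately show ?thesis using t1 arr_map_Arr[OF v1] by (metis imageI)
  qed
  \<comment> \<open>The inverse image that witnesses the inclusion is chosen independently of the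
    one for saturation, so it is unpacked anew.\<close>
  have leS: "(x, y) \<in> S" if xy: "x \<in> Arr U" "y \<in> Arr U" "(arr_map u x, arr_map u y) \<in> R" for x y
  proof -
    obtain v\<^sub>0 v\<^sub>1 t where inv: "is_inverse_image (Cat_over X) u d\<^sub>0 d\<^sub>1 v\<^sub>0 v\<^sub>1 t"
      and rl: "relation_le (Cat_over X) v\<^sub>0 v\<^sub>1 s\<^sub>0 s\<^sub>1"
      using le unfolding inverse_image_le_def by blast
    obtain V where v0: "v\<^sub>0 \<in> hom_set (Cat_over X) V U" and v1: "v\<^sub>1 \<in> hom_set (Cat_over X) V U"
      and ex: "\<And>r a b. r \<in> Arr D \<Longrightarrow> a \<in> Arr U \<Longrightarrow> b \<in> Arr U \<Longrightarrow> arr_map d\<^sub>0 r = arr_map u a \<Longrightarrow>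
        arr_map d\<^sub>1 r = arr_map u b \<Longrightarrow> \<exists>v\<in>Arr V. arr_map v\<^sub>0 v = a \<and> arr_map v\<^sub>1 v = b"
      by (rule is_inverse_imageD[OF d0 d1 u inv]) blast
    obtain i where i: "i \<in> hom_set (Cat_over X) V D\<^sub>S"
      "Comp (Cat_over X) s\<^sub>0 i = v\<^sub>0" "Comp (Cat_over X) s\<^sub>1 i = v\<^sub>1"
      using rl unfolding relation_le_def hom_Dom[OF v0] hom_Dom[OF s0] by blast
    obtain v where v: "v \<in> Arr V" "arr_map v\<^sub>0 v = x" "arr_map v\<^sub>1 v = y"
      using tabulates_ex[OF T xy(3)] ex xy(1,2) by blast
    then show ?thesis
      using tabulates_mem[OF S arr_map_Arr[OF i(1) v(1)]]
      by (simp add: arr_map_Comp_Cat_over[OF i(1) s0 v(1), symmetric]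
          arr_map_Comp_Cat_over[OF i(1) s1 v(1), symmetric] i(2,3))
  qed
  show thesis
  proof (rule that[OF T R])
    fix a b assume ab: "(a, b) \<in> R" and "a \<in> arr_map u ` Arr U \<or> b \<in> arr_map u ` Arr U"
    then obtain x y where xy: "x \<in> Arr U" "y \<in> Arr U" "a = arr_map u x" "b = arr_map u y"
      using sat[OF ab] sat[OF equiv_sym[OF R ab]] by blast
    then show "(a, b) \<in> map_prod (arr_map u) (arr_map u) ` S"
      using leS[OF xy(1,2)] ab map_prod_imageI[of x y S] by simp
  qed
qed

text \<open>A single inverse image, the restriction of \<open>R\<close> to \<open>U\<close>,
  witnesses both saturation and the inclusion in \<open>S\<close>.\<close>

lemma tabulates_saturating_candidate:
  fixes X :: "'u::infinite set"
  assumes u: "u \<in> hom_set (Cat_over X) U C" and inj: "inj_on (arr_map u) (Arr U)"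
    and S: "tabulates X D\<^sub>S s\<^sub>0 s\<^sub>1 U U S"
    and T: "tabulates X D d\<^sub>0 d\<^sub>1 C C R" and R: "equiv (Arr C) R"
    and sat: "\<And>a b. (a, b) \<in> R \<Longrightarrow> a \<in> arr_map u ` Arr U \<or> b \<in> arr_map u ` Arr U \<Longrightarrow>
      (a, b) \<in> map_prod (arr_map u) (arr_map u) ` S"
  shows "saturating_candidate (Cat_over X) u s\<^sub>0 s\<^sub>1 d\<^sub>0 d\<^sub>1"
proof -
  note d0 = tabulates_fst[OF T] and d1 = tabulates_snd[OF T]
  note s0 = tabulates_fst[OF S] and s1 = tabulates_snd[OF S]
  let ?V = "{(a, b). a \<in> Arr U \<and> b \<in> Arr U \<and> (arr_map u a, arr_map u b) \<in> R}"
  have SU: "x \<in> Arr U \<and> y \<in> Arr U" if "(x, y) \<in> S" for x y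
    using compatible_relD(1)[OF tabulates_compatible_rel[OF S] that] by simp
  have "S \<subseteq> Arr U \<times> Arr U" using SU by auto
  \<comment> \<open>Injectivity of \<open>u\<close> lets a pair in the image of \<open>S\<close> be
    pulled back to a pair in \<open>S\<close> itself.\<close>
  then have VS: "(x, y) \<in> S" if "(x, y) \<in> ?V" for x y
    using that sat[of "arr_map u x" "arr_map u y"] map_prod_image_mem_iff[OF inj] by simp
  note relS = compatible_relD(1)[OF tabulates_compatible_rel[OF S] VS]
  have "compatible_rel U U ?V"
  proof (rule compatible_relI)
    fix f g assume fg: "(f, g) \<in> ?V"
    show "f \<in> Arr U \<and> g \<in> Arr U \<and> Dom U f = Dom U g \<and> Cod U f = Cod U g"
      by (rule relS[OF fg])
    fix f' g' assume fg': "(f', g') \<in> ?V" and c: "Cod U f = Dom U f'"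
    have c': "Cod U g = Dom U g'" using c relS[OF fg] relS[OF fg'] by simp
    have R': "(arr_map u f, arr_map u g) \<in> R" "(arr_map u f', arr_map u g') \<in> R"
      and A: "f \<in> Arr U" "g \<in> Arr U" "f' \<in> Arr U" "g' \<in> Arr U"
      using fg fg' by simp_all
    have "(Comp C (arr_map u f') (arr_map u f), Comp C (arr_map u g') (arr_map u g)) \<in> R"
      by (rule compatible_relD(3)[OF tabulates_compatible_rel[OF T] R'])
        (simp add: A c Cod_arr_map[OF u] Dom_arr_map[OF u])
    then show "(Comp U f' f, Comp U g' g) \<in> ?V"
      by (simp add: A c c' arr_map_Comp[OF u] category_Comp[OF hom_category_dom[OF u]])
  next
    fix x assume "x \<in> Obj U"
    then have "Ident U x \<in> Arr U" by (rule category_Ident[OF hom_category_dom[OF u]])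
    then show "(Ident U x, Ident U x) \<in> ?V"
      by (simp add: equiv_refl[OF R arr_map_Arr[OF u]])
  qed
  with hom_Obj_Cat_over(1)[OF u] hom_Obj_Cat_over(1)[OF u]
  obtain V v\<^sub>0 v\<^sub>1 where V: "tabulates X V v\<^sub>0 v\<^sub>1 U U ?V"
    by (rule ex_tabulates)
  note v0 = tabulates_fst[OF V] and v1 = tabulates_snd[OF V]
  note uv0 = Comp_Cat_over_hom[OF v0 u] and uv1 = Comp_Cat_over_hom[OF v1 u]
  have "(arr_map (Comp (Cat_over X) u v\<^sub>0) v, arr_map (Comp (Cat_over X) u v\<^sub>1) v) \<in> R"
    if "v \<in> Arr V" for v
    using tabulates_mem[OF V that]
    by (simp add: arr_map_Comp_Cat_over[OF v0 u that] arr_map_Comp_Cat_over[OF v1 u that])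
  then obtain t where t: "t \<in> hom_set (Cat_over X) V D"
    and t': "Comp (Cat_over X) d\<^sub>0 t = Comp (Cat_over X) u v\<^sub>0"
      "Comp (Cat_over X) d\<^sub>1 t = Comp (Cat_over X) u v\<^sub>1"
    using tabulates_lift[OF T uv0 uv1] by blast
  note t0 = t'(1)[unfolded Comp_eq_iff[OF t v0 d0 u], rule_format]
    and t1 = t'(2)[unfolded Comp_eq_iff[OF t v1 d1 u], rule_format]
  have inv: "is_inverse_image (Cat_over X) u d\<^sub>0 d\<^sub>1 v\<^sub>0 v\<^sub>1 t"
    by (rule is_inverse_imageI[OF T u V t t0 t1])
  have "tabulates X V t v\<^sub>0 D U {(a, b). a \<in> Arr D \<and> b \<in> Arr U \<and> arr_map d\<^sub>0 a = arr_map u b}"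
  proof (rule tabulatesI[OF t v0])
    fix v assume "v \<in> Arr V"
    then show "(arr_map t v, arr_map v\<^sub>0 v) \<in>
        {(a, b). a \<in> Arr D \<and> b \<in> Arr U \<and> arr_map d\<^sub>0 a = arr_map u b}"
      by (simp add: arr_map_Arr[OF t] arr_map_Arr[OF v0] t0)
  next
    fix r x assume "(r, x) \<in> {(a, b). a \<in> Arr D \<and> b \<in> Arr U \<and> arr_map d\<^sub>0 a = arr_map u b}"
    then have r: "r \<in> Arr D" and x: "x \<in> Arr U" and rx: "arr_map d\<^sub>0 r = arr_map u x" by auto
    \<comment> \<open>One end of \<open>r\<close> lies in the image of \<open>u\<close>, hence by
      \<open>sat\<close> so does the other; this is what makes \<open>r\<close> come from
      \<open>V\<close>.\<close>
    have ru: "(arr_map u x, arr_map d\<^sub>1 r) \<in> R"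
      using tabulates_mem[OF T r] rx by simp
    then have "(arr_map u x, arr_map d\<^sub>1 r) \<in> map_prod (arr_map u) (arr_map u) ` S"
      using sat x by blast
    then obtain y where y: "y \<in> Arr U" "arr_map d\<^sub>1 r = arr_map u y"
      using SU by auto
    then obtain v where v: "v \<in> Arr V" "arr_map v\<^sub>0 v = x" "arr_map v\<^sub>1 v = y"
      using tabulates_ex[OF V, of x y] x ru by auto
    have "arr_map t v = r"
      by (rule tabulates_inj[OF T]) (simp_all add: v r y rx t0 t1 arr_map_Arr[OF t])
    with v show "\<exists>v\<in>Arr V. arr_map t v = r \<and> arr_map v\<^sub>0 v = x" by blast
  next
    fix v w assume v: "v \<in> Arr V" "w \<in> Arr V" "arr_map t v = arr_map t w"
      "arr_map v\<^sub>0 v = arr_map v\<^sub>0 w"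
    \<comment> \<open>\<open>t\<close> determines the second projection after \<open>u\<close>, and
      \<open>u\<close> is injective.\<close>
    have "arr_map u (arr_map v\<^sub>1 v) = arr_map u (arr_map v\<^sub>1 w)"
      using t1[OF v(1)] t1[OF v(2)] v(3) by simp
    then have "arr_map v\<^sub>1 v = arr_map v\<^sub>1 w"
      by (rule inj_onD[OF inj _ arr_map_Arr[OF v1 v(1)] arr_map_Arr[OF v1 v(2)]])
    then show "v = w" by (rule tabulates_inj[OF V v(1,2,4)])
  qed
  then have "is_pullback (Cat_over X) d\<^sub>0 u V t v\<^sub>0"
    by (simp only: is_pullback_iff_tabulates[OF d0 u])
  then have "saturated (Cat_over X) u d\<^sub>0 d\<^sub>1"
    using inv unfolding saturated_def hom_Dom[OF v0, symmetric] by blast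
  moreover have "relation_le (Cat_over X) v\<^sub>0 v\<^sub>1 s\<^sub>0 s\<^sub>1"
    unfolding relation_le_def hom_Dom[OF v0] hom_Dom[OF s0]
    using tabulates_lift[OF S v0 v1 VS[OF tabulates_mem[OF V]]] by blast
  ultimately show ?thesis
    using tabulates_internal_equivalence[OF T R] inv
    unfolding saturating_candidate_def inverse_image_le_def hom_Cod[OF u] by blast
qed

theorem proposition5p1:
  fixes X :: "'u::infinite set"
  shows "Equ_saturating (Cat_over X)"
  unfolding Equ_saturating_def
proof (intro conjI allI impI finitely_complete_Cat_over)
  fix u s\<^sub>0 s\<^sub>1 :: "'u io_functor"
  assume asm: "mono_arrow (Cat_over X) u \<and>
    internal_equivalence (Cat_over X) (Dom (Cat_over X) u) s\<^sub>0 s\<^sub>1"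
  define U where "U = Dom (Cat_over X) u"
  define C where "C = Cod (Cat_over X) u"
  have "u \<in> Arr (Cat_over X)" using asm by (simp add: mono_arrow_def)
  then have u: "u \<in> hom_set (Cat_over X) U C" unfolding U_def C_def by (rule Arr_Cat_over_hom)
  have inj: "inj_on (arr_map u) (Arr U)" using mono_arrow_inj[OF _ u] asm by blast
  obtain D\<^sub>S S where S: "tabulates X D\<^sub>S s\<^sub>0 s\<^sub>1 U U S" "equiv (Arr U) S"
    using internal_equivalence_tabulates[OF conjunct2[OF asm]] unfolding U_def by blast
  note C = hom_category_cod[OF u]
  define E where "E = {(a, b) \<in> Arr C \<times> Arr C.
    a \<in> arr_map u ` Arr U \<or> b \<in> arr_map u ` Arr U \<longrightarrow>
      (a, b) \<in> map_prod (arr_map u) (arr_map u) ` S}"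
  have E: "equiv (Arr C) E"
    unfolding E_def by (rule equiv_extend_image[OF S(2) inj]) (auto simp: arr_map_Arr[OF u])
  have "C \<in> Obj (Cat_over X)" using hom_Obj_Cat_over(2)[OF u] .
  then obtain D d\<^sub>0 d\<^sub>1 where T: "tabulates X D d\<^sub>0 d\<^sub>1 C C (syntactic_rel C E)"
    using ex_tabulates[OF _ _ compatible_syntactic_rel[OF C E]] by blast
  have "saturating_candidate (Cat_over X) u s\<^sub>0 s\<^sub>1 d\<^sub>0 d\<^sub>1"
    by (rule tabulates_saturating_candidate[OF u inj S(1) T equiv_syntactic_rel[OF C E]])
      (use syntactic_rel_subset[OF C, of E] in \<open>auto simp: E_def\<close>)
  moreover have "relation_le (Cat_over X) e\<^sub>0 e\<^sub>1 d\<^sub>0 d\<^sub>1"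
    if cand: "saturating_candidate (Cat_over X) u s\<^sub>0 s\<^sub>1 e\<^sub>0 e\<^sub>1" for e\<^sub>0 e\<^sub>1
  proof -
    obtain D' R where R: "tabulates X D' e\<^sub>0 e\<^sub>1 C C R" "equiv (Arr C) R"
      and sat: "\<And>a b. (a, b) \<in> R \<Longrightarrow> a \<in> arr_map u ` Arr U \<or> b \<in> arr_map u ` Arr U \<Longrightarrow>
        (a, b) \<in> map_prod (arr_map u) (arr_map u) ` S"
      using saturating_candidate_tabulates[OF u S(1) cand] by blast
    note e0 = tabulates_fst[OF R(1)] and e1 = tabulates_snd[OF R(1)]
    have "R \<subseteq> E"
    proof
      fix a assume "a \<in> R"
      then show "a \<in> E" using equiv_type[OF R(2)] sat by (cases a) (simp add: E_def; blast)
    qed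
    \<comment> \<open>\<open>R\<close> is compatible because it is tabulated, and reflexive because
      it is an equivalence relation.\<close>
    then have "R \<subseteq> syntactic_rel C E"
      using syntactic_rel_greatest[OF C tabulates_compatible_rel[OF R(1)]] R(2)
      by (auto elim: equivE)
    then have "(arr_map e\<^sub>0 z, arr_map e\<^sub>1 z) \<in> syntactic_rel C E" if "z \<in> Arr D'" for z
      using tabulates_mem[OF R(1) that] by blast
    \<comment> \<open>Inclusion of sets of pairs becomes an arrow between the relations by lifting
      through the tabulation.\<close>
    then show ?thesis
      unfolding relation_le_def hom_Dom[OF e0] hom_Dom[OF tabulates_fst[OF T]]
      using tabulates_lift[OF T e0 e1] by blast
  qed
  ultimately show "\<exists>d\<^sub>0 d\<^sub>1. saturating_candidate (Cat_over X) u s\<^sub>0 s\<^sub>1 d\<^sub>0 d\<^sub>1 \<and>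
      (\<forall>e\<^sub>0 e\<^sub>1. saturating_candidate (Cat_over X) u s\<^sub>0 s\<^sub>1 e\<^sub>0 e\<^sub>1 \<longrightarrow>
        relation_le (Cat_over X) e\<^sub>0 e\<^sub>1 d\<^sub>0 d\<^sub>1)"
    by blast
qed

end
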